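(* Let $\mathcal{A}$ be a semiprime, complex, unital Banach algebra with $\mathrm{soc}(\mathcal{A})\neq\{0\}$, let $x\in\mathcal{A}$, and let $\Omega$ be a connected component of $\rho_{BF}(x)$. Then the following alternative holds (one of the two cases occurs): (1) $x$ has the left SVEP at every point of $\Omega$. In this case, $p_l(x-\lambda)<\infty$ for all $\lambda\in\Omega$. Moreover, $\sigma_l(x)$ does not have limit points in $\Omega$, and $x-\lambda$ is not a left topological divisor of zero for every point $\lambda\in\Omega$, except at most countably many isolated points in $\Omega$. (2) $x$ has the left SVEP at no point of $\Omega$. In this case, $p_l(x-\lambda)=\infty$ for all $\lambda\in\Omega$, and $x-\lambda$ is a left topological divisor of zero for every point $\lambda\in\Omega$.
   Context: An algebra is semiprime if $\{0\}$ is its only two-sided ideal $J$ with $J^2=\{0\}$. $\mathrm{soc}(\mathcal{A})$ is the sum of all minimal right ideals of $\mathcal{A}$ (equal to the sum of all minimal left ideals), or $\{0\}$ if there are none. An element $a$ of a ring is Drazin invertible if there are $b$ in the ring and $k\in\mathbb{N}$ with $bab=b$, $ab=ba$, $a^kba=a^k$. An element $a\in\mathcal{A}$ is B-Fredholm if its image in $\mathcal{A}/\mathrm{soc}(\mathcal{A})$ is Drazin invertible. $x-\lambda$ means $x-\lambda1$. $\sigma_{BF}(x)=\{\lambda\in\mathbb{C}:x-\lambda\text{ is not B-Fredholm}\}$ and $\rho_{BF}(x)=\mathbb{C}\setminus\sigma_{BF}(x)$. $x$ has left SVEP at $\lambda\in\mathbb{C}$ if for every connected open neighbourhood $U$ of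 $\lambda$ the only holomorphic $f:U\to\mathcal{A}$ with $(\mu-x)f(\mu)=0$ for all $\mu\in U$ is $f\equiv0$. $p_l(x)=\inf\{n\ge0:R(x^n)=R(x^{n+1})\}$ (with $\inf\emptyset=\infty$), where $R(y)=\{a\in\mathcal{A}:ya=0\}$. $\sigma_l(x)=\{\lambda\in\mathbb{C}:x-\lambda\text{ is not left invertible}\}$. An element $a\in\mathcal{A}$ is a left topological divisor of zero if there is a sequence $(a_n)$ in $\mathcal{A}$ with $\|a_n\|=1$ for all $n$ and $aa_n\to0$. *)

theory Defs
  imports
    "HOL-Analysis.Analysis"
    "HOL-Algebra.Ideal_Product"
    "HOL-Algebra.QuotRing"
    "HOL-Algebra.Algebraic_Closure_Type"
begin

section \<open>Complex unital Banach algebras\<close>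

text \<open>
  The real structure of the library classes is the restriction of the complex one
  (\<open>scaleR_scaleC\<close>), so the class describes exactly the complex unital Banach algebras with
  \<open>norm 1 = 1\<close>.
\<close>

class complex_banach_algebra_1 = real_normed_algebra_1 + banach +
  fixes scaleC :: "complex \<Rightarrow> 'a \<Rightarrow> 'a" (infixr \<open>*\<^sub>C\<close> 75)
  assumes scaleR_scaleC: "r *\<^sub>R x = complex_of_real r *\<^sub>C x"
    and scaleC_add_right: "c *\<^sub>C (x + y) = c *\<^sub>C x + c *\<^sub>C y"
    and scaleC_add_left: "(c + d) *\<^sub>C x = c *\<^sub>C x + d *\<^sub>C x"
    and scaleC_scaleC: "c *\<^sub>C d *\<^sub>C x = (c * d) *\<^sub>C x"
    and scaleC_one: "1 *\<^sub>C x = x"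
    and mult_scaleC_left: "(c *\<^sub>C x) * y = c *\<^sub>C (x * y)"
    and mult_scaleC_right: "x * (c *\<^sub>C y) = c *\<^sub>C (x * y)"
    and norm_scaleC: "norm (c *\<^sub>C x) = cmod c * norm x"

text \<open>Complex differentiability at every point of the open set \<open>U\<close>: the real Frechet
  derivative exists and is multiplication by a vector \<open>d\<close>, i.e. it is complex linear.\<close>

definition holomorphic_vec :: "(complex \<Rightarrow> 'a::complex_banach_algebra_1) \<Rightarrow> complex set \<Rightarrow> bool" where
  "holomorphic_vec f U \<longleftrightarrow>
     (\<forall>\<mu>\<in>U. \<exists>d. (f has_derivative (\<lambda>h. h *\<^sub>C d)) (at \<mu>))"


section \<open>Ideals, socle, B-Fredholm elements\<close>

abbreviation alg_ring :: "'a::complex_banach_algebra_1 ring" where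
  "alg_ring \<equiv> ring_of_type_algebra"

text \<open>Ideals are taken in the ring-theoretic sense; since the algebra is unital they are
  automatically complex subspaces (\<open>c *\<^sub>C a = a * (c *\<^sub>C 1)\<close>).\<close>

definition right_ideal :: "'a::complex_banach_algebra_1 set \<Rightarrow> bool" where
  "right_ideal I \<longleftrightarrow> additive_subgroup I alg_ring \<and> (\<forall>a\<in>I. \<forall>b. a * b \<in> I)"

lemma right_ideal_scaleC:
  fixes a :: "'a::complex_banach_algebra_1"
  assumes "right_ideal I" "a \<in> I"
  shows "c *\<^sub>C a \<in> I"
proof -
  have "a * (c *\<^sub>C 1) \<in> I"
    using assms by (auto simp: right_ideal_def)
  thus ?thesis
    by (simp add: mult_scaleC_right)
qed

definition minimal_right_ideal :: "'a::complex_banach_algebra_1 set \<Rightarrow> bool" where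
  "minimal_right_ideal I \<longleftrightarrow>
     right_ideal I \<and> I \<noteq> {0} \<and> (\<forall>J. right_ideal J \<and> J \<subseteq> I \<longrightarrow> J = {0} \<or> J = I)"

text \<open>If there are no minimal right ideals, only the empty sum remains and the socle is
  \<open>{0}\<close>.\<close>

definition soc :: "'a::complex_banach_algebra_1 set" where
  "soc = {sum f F | f F. finite F \<and> (\<forall>I\<in>F. minimal_right_ideal I \<and> f I \<in> I)}"

definition semiprime_algebra :: "'a::complex_banach_algebra_1 itself \<Rightarrow> bool" where
  "semiprime_algebra _ \<longleftrightarrow>
     (\<forall>J::'a set. ideal J alg_ring \<and> ideal_prod alg_ring J J = {0} \<longrightarrow> J = {0})"

definition drazin_invertible :: "('b, 'm) ring_scheme \<Rightarrow> 'b \<Rightarrow> bool" where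
  "drazin_invertible R a \<longleftrightarrow>
     (\<exists>b\<in>carrier R. \<exists>k::nat.
        b \<otimes>\<^bsub>R\<^esub> a \<otimes>\<^bsub>R\<^esub> b = b \<and>
        a \<otimes>\<^bsub>R\<^esub> b = b \<otimes>\<^bsub>R\<^esub> a \<and>
        a [^]\<^bsub>R\<^esub> k \<otimes>\<^bsub>R\<^esub> b \<otimes>\<^bsub>R\<^esub> a = a [^]\<^bsub>R\<^esub> k)"

definition B_Fredholm :: "'a::complex_banach_algebra_1 \<Rightarrow> bool" where
  "B_Fredholm a \<longleftrightarrow> drazin_invertible (alg_ring Quot soc) (soc +>\<^bsub>alg_ring\<^esub> a)"

definition shift :: "'a::complex_banach_algebra_1 \<Rightarrow> complex \<Rightarrow> 'a" where
  "shift x z = x - z *\<^sub>C 1"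

definition sigma_BF :: "'a::complex_banach_algebra_1 \<Rightarrow> complex set" where
  "sigma_BF x = {z. \<not> B_Fredholm (shift x z)}"

definition rho_BF :: "'a::complex_banach_algebra_1 \<Rightarrow> complex set" where
  "rho_BF x = - sigma_BF x"


section \<open>Left SVEP, left spectrum, left topological divisors of zero\<close>

definition left_SVEP_at :: "'a::complex_banach_algebra_1 \<Rightarrow> complex \<Rightarrow> bool" where
  "left_SVEP_at x z \<longleftrightarrow>
     (\<forall>U. open U \<and> connected U \<and> z \<in> U \<longrightarrow>
        (\<forall>f. holomorphic_vec f U \<and> (\<forall>\<mu>\<in>U. (\<mu> *\<^sub>C 1 - x) * f \<mu> = 0) \<longrightarrow> (\<forall>\<mu>\<in>U. f \<mu> = 0)))"

definition right_annihilator :: "'a::complex_banach_algebra_1 \<Rightarrow> 'a set" where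
  "right_annihilator y = {a. y * a = 0}"

text \<open>In \<^typ>\<open>enat\<close> the infimum of the empty set is \<open>\<infinity>\<close>.\<close>

definition p_l :: "'a::complex_banach_algebra_1 \<Rightarrow> enat" where
  "p_l x = Inf {enat n | n. right_annihilator (x ^ n) = right_annihilator (x ^ (n + 1))}"

definition left_invertible :: "'a::complex_banach_algebra_1 \<Rightarrow> bool" where
  "left_invertible a \<longleftrightarrow> (\<exists>b. b * a = 1)"

definition sigma_l :: "'a::complex_banach_algebra_1 \<Rightarrow> complex set" where
  "sigma_l x = {z. \<not> left_invertible (shift x z)}"

definition left_topological_zero_divisor :: "'a::complex_banach_algebra_1 \<Rightarrow> bool" where
  "left_topological_zero_divisor a \<longleftrightarrow>
     (\<exists>s::nat \<Rightarrow> 'a. (\<forall>n. norm (s n) = 1) \<and> (\<lambda>n. a * s n) \<longlonglongrightarrow> 0)"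

end

theory Submission
  imports Defs "HOL-Complex_Analysis.Conformal_Mappings"
begin

text \<open>
  In a semiprime algebra every element of the socle is von Neumann regular, so an element that is
  regular modulo the socle is regular. If \<open>y = x - \<lambda>\<close> is B-Fredholm, then all powers \<open>y^j\<close> with
  \<open>j\<close> large are regular modulo the socle, hence regular. This settles the situation near \<open>\<lambda>\<close>:

  \<^item> If \<open>R(y^n) = R(y^(n + 1))\<close> with \<open>n\<close> large and \<open>c\<close> is a generalised inverse of \<open>y^(n + 1)\<close>,
    then \<open>w = y^n c\<close> satisfies \<open>w y^(n + 1) = y^n\<close>, so that \<open>(1 - \<mu> w)^(-1) w (y - \<mu>) y^n = y^n\<close>
    for small \<open>\<mu>\<close>. As \<open>y - \<mu>\<close> divides \<open>y^n - \<mu>^n\<close>, it is left invertible for small \<open>\<mu> \<noteq> 0\<close>.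
  \<^item> If \<open>p_l(y) = \<infinity>\<close>, the descending chain condition for right ideals in \<open>sA\<close>, \<open>s\<close> in the socle,
    yields \<open>g \<noteq> 0\<close> and \<open>w\<close> with \<open>y g = 0\<close> and \<open>y w^(i + 1) g = w^i g\<close>, and
    \<open>\<mu> \<mapsto> (1 - \<mu> w)^(-1) g\<close> is a zero-free holomorphic solution of \<open>(y - \<mu>) f(\<mu>) = 0\<close>.

  So finiteness of \<open>p_l(x - \<lambda>)\<close> is locally constant on \<open>\<Omega>\<close>, and connectedness gives the
  alternative. The left SVEP in the first case uses the identity theorem for vector-valued
  functions, obtained from the scalar one by the Hahn-Banach theorem.
\<close>

section \<open>Right ideals and semiprimeness\<close>

lemma ring_alg_ring: "ring (alg_ring :: 'a::complex_banach_algebra_1 ring)"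
proof -
  have "\<exists>y. x + y = 0" for x :: 'a
    using add.right_inverse by blast
  thus ?thesis
    unfolding ring_of_type_algebra_def
    by unfold_locales (auto simp: algebra_simps Units_def)
qed

lemma alg_ring_simps [simp]:
  "carrier alg_ring = UNIV" "a \<otimes>\<^bsub>alg_ring\<^esub> b = a * b" "a \<oplus>\<^bsub>alg_ring\<^esub> b = a + b"
  "\<zero>\<^bsub>alg_ring\<^esub> = 0" "\<one>\<^bsub>alg_ring\<^esub> = 1"
  by (simp_all add: ring_of_type_algebra_def)

lemma a_inv_alg_ring [simp]: "\<ominus>\<^bsub>alg_ring\<^esub> a = - (a::'a::complex_banach_algebra_1)"
proof -
  interpret ring "alg_ring :: 'a ring" by (rule ring_alg_ring)
  show ?thesis by (rule minus_equality) auto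
qed

lemma additive_subgroup_alg_ringI:
  fixes I :: "'a::complex_banach_algebra_1 set"
  assumes "0 \<in> I" "\<And>a b. a \<in> I \<Longrightarrow> b \<in> I \<Longrightarrow> a + b \<in> I" "\<And>a. a \<in> I \<Longrightarrow> - a \<in> I"
  shows "additive_subgroup I alg_ring"
proof -
  interpret ring "alg_ring :: 'a ring" by (rule ring_alg_ring)
  show ?thesis
    using assms by (intro additive_subgroup.intro add.subgroupI) (auto simp flip: a_inv_def)
qed

lemma right_idealI:
  fixes I :: "'a::complex_banach_algebra_1 set"
  assumes "0 \<in> I" "\<And>a b. a \<in> I \<Longrightarrow> b \<in> I \<Longrightarrow> a + b \<in> I" "\<And>a b. a \<in> I \<Longrightarrow> a * b \<in> I"
  shows "right_ideal I"
  unfolding right_ideal_def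
proof (intro conjI additive_subgroup_alg_ringI)
  show "- a \<in> I" if "a \<in> I" for a
    using assms(3)[OF that, of "- 1"] by simp
qed (use assms in auto)

lemma
  assumes "right_ideal I"
  shows right_ideal_zero: "0 \<in> I"
    and right_ideal_add: "a \<in> I \<Longrightarrow> b \<in> I \<Longrightarrow> a + b \<in> I"
    and right_ideal_mult: "a \<in> I \<Longrightarrow> a * c \<in> I"
  using assms additive_subgroup.zero_closed[of I alg_ring] additive_subgroup.a_closed[of I alg_ring]
  by (auto simp: right_ideal_def)

lemma right_ideal_uminus: "right_ideal I \<Longrightarrow> a \<in> I \<Longrightarrow> - a \<in> I"
  using right_ideal_mult[of I a "- 1"] by simp

lemma right_ideal_diff: "right_ideal I \<Longrightarrow> a \<in> I \<Longrightarrow> b \<in> I \<Longrightarrow> a - b \<in> I"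
  using right_ideal_add[of I a "- b"] right_ideal_uminus by fastforce


lemma right_ideal_right_annihilator: "right_ideal (right_annihilator a)"
  by (rule right_idealI) (auto simp: right_annihilator_def distrib_left simp flip: mult.assoc)

lemma right_ideal_Int: "right_ideal I \<Longrightarrow> right_ideal J \<Longrightarrow> right_ideal (I \<inter> J)"
  by (rule right_idealI) (auto simp: right_ideal_zero right_ideal_add right_ideal_mult)

lemma right_ideal_mult_image: "right_ideal I \<Longrightarrow> right_ideal ((*) a ` I)"
proof (rule right_idealI)
  assume I: "right_ideal I"
  show "0 \<in> (*) a ` I"
    using right_ideal_zero[OF I] by (metis image_eqI mult_zero_right)
  show "b + c \<in> (*) a ` I" if "b \<in> (*) a ` I" "c \<in> (*) a ` I" for b c
    using that right_ideal_add[OF I] by (auto simp flip: distrib_left)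
  show "b * c \<in> (*) a ` I" if "b \<in> (*) a ` I" for b c
    using that right_ideal_mult[OF I] by (auto simp: mult.assoc)
qed

lemma right_ideal_range_mult: "right_ideal (range ((*) (a::'a::complex_banach_algebra_1)))"
  by (rule right_ideal_mult_image) (rule right_idealI, auto)

lemma alg_ideal_iff:
  fixes J :: "'a::complex_banach_algebra_1 set"
  shows "ideal J alg_ring \<longleftrightarrow> right_ideal J \<and> (\<forall>a\<in>J. \<forall>b. b * a \<in> J)"
proof -
  interpret ring "alg_ring :: 'a ring" by (rule ring_alg_ring)
  show ?thesis
    by (auto simp: ideal_def ideal_axioms_def right_ideal_def ring_axioms)
qed

lemma minimal_right_idealD: "minimal_right_ideal I \<Longrightarrow> right_ideal I"
  by (simp add: minimal_right_ideal_def)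

lemma minimal_right_ideal_subset:
  "minimal_right_ideal I \<Longrightarrow> right_ideal J \<Longrightarrow> J \<subseteq> I \<Longrightarrow> a \<in> J \<Longrightarrow> a \<noteq> 0 \<Longrightarrow> J = I"
  by (auto simp: minimal_right_ideal_def)

text \<open>Left multiplication by \<open>a\<close> is right linear, so a right ideal inside
  \<open>aI\<close> pulls back to a right ideal inside \<open>I\<close>, to which minimality
  applies.\<close>

lemma minimal_right_ideal_mult_image:
  assumes I: "minimal_right_ideal I"
  shows "(*) a ` I = {0} \<or> minimal_right_ideal ((*) a ` I)"
proof -
  note rI = minimal_right_idealD[OF I]
  have "J = {0} \<or> J = (*) a ` I" if J: "right_ideal J" "J \<subseteq> (*) a ` I" for J
  proof -
    let ?P = "{i \<in> I. a * i \<in> J}"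
    have "right_ideal ?P"
      by (rule right_idealI) (auto simp: right_ideal_zero right_ideal_add right_ideal_mult rI J(1)
            distrib_left simp flip: mult.assoc)
    hence "?P = {0} \<or> ?P = I"
      using I unfolding minimal_right_ideal_def by blast
    thus ?thesis
    proof
      assume P: "?P = {0}"
      have "z = 0" if z: "z \<in> J" for z
      proof -
        obtain i where i: "i \<in> I" "z = a * i" using z J(2) by blast
        hence "i \<in> ?P" using z by blast
        hence "i = 0" using P by blast
        thus ?thesis using i by simp
      qed
      thus ?thesis using right_ideal_zero[OF J(1)] by blast
    next
      assume "?P = I"
      thus ?thesis using J(2) by blast
    qed
  qed
  thus ?thesis
    using right_ideal_mult_image[OF rI] unfolding minimal_right_ideal_def by blast
qed

text \<open>The two-sided ideal with square zero is the right annihilator of \<open>I\<close> intersected with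
  the left annihilator of that annihilator.\<close>

lemma semiprime_right_ideal_square_nonzero:
  fixes I :: "'a::complex_banach_algebra_1 set"
  assumes sp: "semiprime_algebra TYPE('a)" and I: "right_ideal I" "I \<noteq> {0}"
  shows "\<exists>a\<in>I. \<exists>b\<in>I. a * b \<noteq> 0"
proof (rule ccontr)
  assume "\<not> ?thesis"
  hence 0: "a * b = 0" if "a \<in> I" "b \<in> I" for a b
    using that by blast
  define J where "J = {z. (\<forall>i\<in>I. i * z = 0) \<and> (\<forall>t. (\<forall>i\<in>I. i * t = 0) \<longrightarrow> z * t = 0)}"
  have lm: "i * (b * z) = 0" if "\<forall>i\<in>I. i * z = 0" "i \<in> I" for i b z
    using that right_ideal_mult[OF I(1)] by (simp flip: mult.assoc)
  have "right_ideal J"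
  proof (rule right_idealI)
    fix a b assume "a \<in> J"
    thus "a * b \<in> J"
      unfolding J_def by (auto simp: mult.assoc lm) (metis mult.assoc mult_zero_left)
  qed (auto simp: J_def distrib_left distrib_right)
  moreover have "b * a \<in> J" if "a \<in> J" for a b
    using that lm by (auto simp: J_def mult.assoc)
  ultimately have id: "ideal J alg_ring"
    by (simp add: alg_ideal_iff)
  have "z = 0" if "z \<in> ideal_prod alg_ring J J" for z
    using that by induction (auto simp: J_def)
  moreover have "0 \<in> ideal_prod alg_ring J J"
    using ideal_prod.prod[of 0 J 0 J alg_ring] by (simp add: J_def)
  ultimately have "ideal_prod alg_ring J J = {0}" by blast
  hence "J = {0}"
    using sp id unfolding semiprime_algebra_def by blast
  moreover have "I \<subseteq> J"
    by (auto simp: J_def 0)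
  ultimately show False
    using I right_ideal_zero by blast
qed

text \<open>Brauer's lemma: since \<open>I\<close> has nonzero square, some \<open>a\<close> in
  \<open>I\<close> satisfies \<open>aI = I\<close>, and the solution \<open>e\<close> in
  \<open>I\<close> of \<open>a = a * e\<close> is idempotent.\<close>

lemma minimal_right_ideal_idempotent:
  fixes I :: "'a::complex_banach_algebra_1 set"
  assumes sp: "semiprime_algebra TYPE('a)" and I: "minimal_right_ideal I"
  obtains e where "e * e = e" "I = range ((*) e)"
proof -
  note rI = minimal_right_idealD[OF I]
  obtain a b where ab: "a \<in> I" "b \<in> I" "a * b \<noteq> 0"
    using semiprime_right_ideal_square_nonzero[OF sp rI] I by (auto simp: minimal_right_ideal_def)
  have "(*) a ` I = I"
    by (rule minimal_right_ideal_subset[OF I right_ideal_mult_image[OF rI], of _ "a * b"])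
      (use ab right_ideal_mult[OF rI] in auto)
  then obtain e where e: "e \<in> I" "a = a * e"
    using ab(1) by blast
  \<comment> \<open>Minimality makes left multiplication by \<open>a\<close> injective on
    \<open>I\<close>, because \<open>a * b \<noteq> 0\<close> excludes
    \<open>?Z = I\<close>.\<close>
  let ?Z = "I \<inter> right_annihilator a"
  have "?Z \<noteq> I"
    using ab by (auto simp: right_annihilator_def)
  hence Z: "?Z = {0}"
    using I right_ideal_Int[OF rI right_ideal_right_annihilator, of a]
    unfolding minimal_right_ideal_def by blast
  have "a * (e * e - e) = 0"
    using e(2) by (simp add: right_diff_distrib flip: mult.assoc)
  moreover have "e * e - e \<in> I"
    using e(1) rI by (simp add: right_ideal_diff right_ideal_mult)
  ultimately have "e * e - e \<in> ?Z"
    by (simp add: right_annihilator_def)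
  hence "e * e - e = 0"
    using Z by blast
  hence ee: "e * e = e" by simp
  have "a \<noteq> 0" using ab by auto
  hence "e \<noteq> 0" using e by auto
  hence "range ((*) e) = I"
    by (intro minimal_right_ideal_subset[OF I right_ideal_range_mult, of _ e])
      (use e rI right_ideal_mult in \<open>auto intro: range_eqI[of _ _ 1]\<close>)
  thus ?thesis using that ee by metis
qed

section \<open>The socle\<close>

lemma soc_zero: "0 \<in> soc"
  unfolding soc_def by (auto intro!: exI[of _ "{}"])

lemma soc_add_minimal:
  assumes "p \<in> soc" "minimal_right_ideal I" "i \<in> I"
  shows "p + i \<in> soc"
proof -
  obtain F f where F: "p = sum f F" "finite F" "\<forall>I\<in>F. minimal_right_ideal I \<and> f I \<in> I"
    using assms(1) by (auto simp: soc_def)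
  \<comment> \<open>The family in \<open>soc\<close> is indexed by the ideals themselves, so if
    \<open>I\<close> already occurs in \<open>F\<close>, its term must absorb
    \<open>i\<close>.\<close>
  define g where "g = (\<lambda>J. (if J \<in> F then f J else 0) + (if J = I then i else 0))"
  have "sum g (insert I F) = p + i"
    using F(1,2) by (simp add: g_def sum.distrib sum.If_cases Int_absorb1 insert_absorb subset_insertI)
  moreover have "minimal_right_ideal J \<and> g J \<in> J" if "J \<in> insert I F" for J
    using that F(3) assms(2,3) minimal_right_idealD[of J]
    by (auto simp: g_def right_ideal_add right_ideal_zero)
  ultimately show ?thesis
    using F(2) unfolding soc_def by (intro CollectI exI[of _ g] exI[of _ "insert I F"]) auto
qed

lemma soc_induct [consumes 1, case_names zero add]:
  assumes "s \<in> soc" and zero: "P 0"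
    and add: "\<And>p I i. p \<in> soc \<Longrightarrow> P p \<Longrightarrow> minimal_right_ideal I \<Longrightarrow> i \<in> I \<Longrightarrow> P (p + i)"
  shows "P s"
proof -
  obtain F f where F: "s = sum f F" "finite F" "\<forall>I\<in>F. minimal_right_ideal I \<and> f I \<in> I"
    using assms(1) by (auto simp: soc_def)
  have "P (sum f F) \<and> sum f F \<in> soc"
    using F(2,3)
  proof (induction F)
    case empty
    thus ?case using zero soc_zero by simp
  next
    case (insert I F)
    thus ?case
      using add[of "sum f F" I "f I"] soc_add_minimal[of "sum f F" I "f I"]
      by (simp add: add.commute)
  qed
  thus ?thesis using F(1) by simp
qed

text \<open>Closure under left multiplication holds because \<open>bI\<close> is zero or again a
  minimal right ideal.\<close>

lemma ideal_soc: "ideal (soc :: 'a::complex_banach_algebra_1 set) alg_ring"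
  unfolding alg_ideal_iff
proof (intro conjI ballI allI right_idealI soc_zero)
  fix a b :: 'a assume a: "a \<in> soc"
  { assume b: "b \<in> soc"
    show "a + b \<in> soc"
      using b by (induction rule: soc_induct) (auto simp: a soc_add_minimal simp flip: add.assoc) }
  show "a * b \<in> soc"
    using a
    by (induction rule: soc_induct)
      (auto simp: soc_zero distrib_right
        intro: soc_add_minimal right_ideal_mult minimal_right_idealD)
  show "b * a \<in> soc"
    using a
  proof (induction rule: soc_induct)
    case (add p I i)
    have i: "b * i \<in> (*) b ` I" using add.hyps by blast
    from minimal_right_ideal_mult_image[OF add.hyps(2), of b] show ?case
    proof
      assume "(*) b ` I = {0}"
      thus ?thesis using i add.IH by (simp add: distrib_left)
    next
      assume "minimal_right_ideal ((*) b ` I)"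
      thus ?thesis using soc_add_minimal[OF add.IH _ i] by (simp add: distrib_left)
    qed
  qed (auto simp: soc_zero)
qed

lemma
  shows soc_add: "a \<in> soc \<Longrightarrow> b \<in> soc \<Longrightarrow> a + b \<in> soc"
    and soc_diff: "a \<in> soc \<Longrightarrow> b \<in> soc \<Longrightarrow> a - b \<in> soc"
    and soc_mult_right: "a \<in> soc \<Longrightarrow> a * c \<in> soc"
    and soc_mult_left: "a \<in> soc \<Longrightarrow> c * a \<in> soc"
  using ideal_soc unfolding alg_ideal_iff
  by (auto intro: right_ideal_add right_ideal_diff right_ideal_mult)

text \<open>The sums need not be direct. Building them one summand at a time allows induction on the
  number of summands for the chain condition and for idempotent generators.\<close>

inductive finite_minimal_sum :: "'a::complex_banach_algebra_1 set \<Rightarrow> bool" where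
  zero: "finite_minimal_sum {0}"
| add: "finite_minimal_sum P \<Longrightarrow> minimal_right_ideal I \<Longrightarrow>
    finite_minimal_sum {p + i | p i. p \<in> P \<and> i \<in> I}"

lemma finite_minimal_sum_right_ideal: "finite_minimal_sum P \<Longrightarrow> right_ideal P"
proof (induction rule: finite_minimal_sum.induct)
  case (add P I)
  note P = add.IH and I = minimal_right_idealD[OF add.hyps(2)]
  show ?case
  proof (rule right_idealI)
    show "0 \<in> {p + i |p i. p \<in> P \<and> i \<in> I}"
      using P I right_ideal_zero by force
  next
    fix a b assume "a \<in> {p + i |p i. p \<in> P \<and> i \<in> I}" "b \<in> {p + i |p i. p \<in> P \<and> i \<in> I}"
    then obtain p i q j where *: "a = p + i" "b = q + j" "p \<in> P" "q \<in> P" "i \<in> I" "j \<in> I"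
      by auto
    have "a + b = (p + q) + (i + j)" using * by simp
    thus "a + b \<in> {p + i |p i. p \<in> P \<and> i \<in> I}"
      using * P I right_ideal_add by blast
  next
    fix a b assume "a \<in> {p + i |p i. p \<in> P \<and> i \<in> I}"
    then obtain p i where *: "a = p + i" "p \<in> P" "i \<in> I"
      by auto
    have "a * b = p * b + i * b" using * by (simp add: distrib_right)
    thus "a * b \<in> {p + i |p i. p \<in> P \<and> i \<in> I}"
      using * P I right_ideal_mult by blast
  qed
qed (auto intro!: right_idealI)

lemma soc_in_finite_minimal_sum: "s \<in> soc \<Longrightarrow> \<exists>P. finite_minimal_sum P \<and> s \<in> P"
proof (induction rule: soc_induct)
  case (add p I i)
  then obtain P where "finite_minimal_sum P" "p \<in> P" by blast
  thus ?case
    using finite_minimal_sum.add[of P I] add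
    by (intro exI[of _ "{p + i |p i. p \<in> P \<and> i \<in> I}"]) auto
qed (auto intro: finite_minimal_sum.zero)

text \<open>The set is \<open>I\<close> intersected with \<open>P + K\<close>, a right ideal inside
  the minimal \<open>I\<close>. It plays the role of a projection of \<open>K\<close> to
  \<open>I\<close> along \<open>P\<close>, even if \<open>P\<close> meets \<open>I\<close>.\<close>

lemma right_ideal_projection:
  assumes "right_ideal P" "right_ideal K"
    and I: "minimal_right_ideal I"
  shows "{i \<in> I. \<exists>p\<in>P. p + i \<in> K} = {0} \<or> {i \<in> I. \<exists>p\<in>P. p + i \<in> K} = I"
proof -
  note rI = minimal_right_idealD[OF I]
  have "right_ideal {i \<in> I. \<exists>p\<in>P. p + i \<in> K}"
  proof (rule right_idealI)
    fix a b assume "a \<in> {i \<in> I. \<exists>p\<in>P. p + i \<in> K}" "b \<in> {i \<in> I. \<exists>p\<in>P. p + i \<in> K}"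
    then obtain p q where *: "a \<in> I" "b \<in> I" "p \<in> P" "q \<in> P" "p + a \<in> K" "q + b \<in> K"
      by auto
    hence "(p + q) + (a + b) \<in> K"
      using right_ideal_add[OF assms(2) *(5,6)] by (simp add: algebra_simps)
    thus "a + b \<in> {i \<in> I. \<exists>p\<in>P. p + i \<in> K}"
      using * right_ideal_add[OF rI] right_ideal_add[OF assms(1)] by blast
  next
    fix a b assume "a \<in> {i \<in> I. \<exists>p\<in>P. p + i \<in> K}"
    then obtain p where *: "a \<in> I" "p \<in> P" "p + a \<in> K"
      by auto
    hence "p * b + a * b \<in> K"
      using right_ideal_mult[OF assms(2) *(3), of b] by (simp add: algebra_simps)
    thus "a * b \<in> {i \<in> I. \<exists>p\<in>P. p + i \<in> K}"
      using * right_ideal_mult[OF rI] right_ideal_mult[OF assms(1)] by blast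
  next
    show "0 \<in> {i \<in> I. \<exists>p\<in>P. p + i \<in> K}"
      using assms rI right_ideal_zero by force
  qed
  thus ?thesis
    using I unfolding minimal_right_ideal_def by blast
qed

text \<open>Elements of \<open>K\<close> and \<open>L\<close> with the same \<open>I\<close>-part
  differ by an element of \<open>K \<inter> P\<close>, which already lies in \<open>L\<close>. This
  replaces a comparison of module lengths in the inductions below.\<close>

lemma right_ideal_eq_of_projection:
  assumes P: "right_ideal P" and K: "right_ideal K" "right_ideal L" "L \<subseteq> K"
    and sub: "K \<subseteq> {p + i | p i. p \<in> P \<and> i \<in> I}"
    and int: "K \<inter> P \<subseteq> L"
    and proj: "{i \<in> I. \<exists>p\<in>P. p + i \<in> K} \<subseteq> {i \<in> I. \<exists>p\<in>P. p + i \<in> L}"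
  shows "K = L"
proof
  show "K \<subseteq> L"
  proof
    fix z assume z: "z \<in> K"
    then obtain p i where pi: "z = p + i" "p \<in> P" "i \<in> I"
      using sub by blast
    then obtain q where q: "q \<in> P" "q + i \<in> L"
      using proj z by blast
    have "z - (q + i) \<in> K"
      using right_ideal_diff[OF K(1) z] q K(3) by blast
    moreover have "z - (q + i) \<in> P"
      using right_ideal_diff[OF P pi(2) q(1)] by (simp add: pi(1))
    ultimately have "z - (q + i) \<in> L"
      using int by blast
    thus "z \<in> L"
      using right_ideal_add[OF K(2) _ q(2)] by fastforce
  qed
qed (fact K)

text \<open>Induction on the summands: the traces \<open>K j \<inter> P\<close> stabilise by the
  induction hypothesis, and the parts in \<open>I\<close> form a decreasing sequence with only the
  values \<open>{0}\<close> and \<open>I\<close>.\<close>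

lemma finite_minimal_sum_dcc:
  fixes K :: "nat \<Rightarrow> 'a::complex_banach_algebra_1 set"
  assumes "finite_minimal_sum P" "\<And>j. right_ideal (K j)" "decseq K" "\<And>j. K j \<subseteq> P"
  shows "\<exists>m. \<forall>j\<ge>m. K j = K m"
  using assms
proof (induction arbitrary: K rule: finite_minimal_sum.induct)
  case zero
  hence "K j = {0}" for j
    using right_ideal_zero by blast
  thus ?case by blast
next
  case (add P I)
  note P = finite_minimal_sum_right_ideal[OF add.hyps(1)]
  let ?Q = "\<lambda>j. {i \<in> I. \<exists>p\<in>P. p + i \<in> K j}"
  have "\<exists>m. \<forall>j\<ge>m. K j \<inter> P = K m \<inter> P"
    using add.IH[of "\<lambda>j. K j \<inter> P"] right_ideal_Int[OF add.prems(1) P] add.prems(2)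
    by (force simp: decseq_def)
  then obtain m where m: "K j \<inter> P = K m \<inter> P" if "j \<ge> m" for j by blast
  have Q: "?Q j = {0} \<or> ?Q j = I" for j
    by (rule right_ideal_projection[OF P add.prems(1) add.hyps(2)])
  have Qmono: "?Q j \<subseteq> ?Q i" if "i \<le> j" for i j
    using decseqD[OF add.prems(2) that] by blast
  have "\<exists>n. \<forall>j\<ge>n. ?Q j = ?Q n"
  proof (cases "\<exists>n. ?Q n = {0}")
    case True
    then obtain n where n: "?Q n = {0}" by blast
    have "?Q j = ?Q n" if "j \<ge> n" for j
    proof -
      have "?Q j \<subseteq> {0}" using Qmono[OF that] n by blast
      hence "?Q j = {0}" using Q[of j] right_ideal_zero[OF minimal_right_idealD[OF add.hyps(2)]]
        by blast
      thus ?thesis using n by simp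
    qed
    thus ?thesis by blast
  next
    case False
    hence "?Q j = I" for j using Q by blast
    thus ?thesis by blast
  qed
  then obtain n where n: "?Q j = ?Q n" if "j \<ge> n" for j by blast
  have "K j = K (max m n)" if "j \<ge> max m n" for j
  proof (rule sym, rule right_ideal_eq_of_projection[OF P add.prems(1) add.prems(1)])
    show "K j \<subseteq> K (max m n)"
      using decseqD[OF add.prems(2) that] .
    show "K (max m n) \<inter> P \<subseteq> K j"
      using m[of "max m n"] m[of j] that by auto
    show "?Q (max m n) \<subseteq> ?Q j"
      using n[of "max m n"] n[of j] that by auto
  qed (use add.prems(3) in blast)
  thus ?case by blast
qed

text \<open>With \<open>N \<inter> P = eA\<close> from the induction hypothesis, \<open>N\<close> is the direct sum of \<open>eA\<close> and
  the right ideal \<open>(1 - e)N\<close>, which embeds into \<open>I\<close> and hence is zero or minimal; the two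
  idempotents are then merged into one.\<close>

lemma finite_minimal_sum_idempotent:
  fixes N :: "'a::complex_banach_algebra_1 set"
  assumes sp: "semiprime_algebra TYPE('a)"
    and "finite_minimal_sum P" "right_ideal N" "N \<subseteq> P"
  shows "\<exists>e. e * e = e \<and> N = range ((*) e)"
  using assms(2-)
proof (induction arbitrary: N rule: finite_minimal_sum.induct)
  case zero
  hence "N = {0}" using right_ideal_zero by blast
  thus ?case by (intro exI[of _ 0]) auto
next
  case (add P I)
  note P = finite_minimal_sum_right_ideal[OF add.hyps(1)]
  obtain e where e: "e * e = e" "N \<inter> P = range ((*) e)"
    using add.IH[of "N \<inter> P"] right_ideal_Int[OF add.prems(1) P] by blast
  have eN: "e \<in> N"
    using e(2) by (metis Int_iff mult_1_right rangeI)
  have ez: "e * z = z" if "z \<in> N" "z \<in> P" for z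
    using that e by (metis Int_iff imageE mult.assoc)
  define N' where "N' = {z \<in> N. e * z = 0}"
  have N': "right_ideal N'"
    unfolding N'_def using add.prems(1)
    by (intro right_idealI)
      (auto simp: right_ideal_zero right_ideal_add right_ideal_mult distrib_left simp flip: mult.assoc)
  have N'P: "z = 0" if "z \<in> N'" "z \<in> P" for z
    using that ez[of z] by (auto simp: N'_def)
  have "N' = {0} \<or> minimal_right_ideal N'"
  proof -
    have "J = {0} \<or> J = N'" if J: "right_ideal J" "J \<subseteq> N'" for J
    proof -
      let ?Q = "{i \<in> I. \<exists>p\<in>P. p + i \<in> J}"
      consider "?Q = {0}" | "?Q = I"
        using right_ideal_projection[OF P J(1) add.hyps(2)] by blast
      thus ?thesis
      proof cases
        case 1
        have "z = 0" if z: "z \<in> J" for z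
        proof -
          have "z \<in> N" using z J by (auto simp: N'_def)
          then obtain p i where pi: "z = p + i" "p \<in> P" "i \<in> I"
            using add.prems(2) by blast
          hence "i \<in> ?Q" using z by blast
          hence "i = 0" using 1 by blast
          thus ?thesis using N'P[of z] z J(2) pi by auto
        qed
        thus ?thesis using right_ideal_zero[OF J(1)] by blast
      next
        case 2
        have "N' = J"
        proof (rule right_ideal_eq_of_projection[OF P N' J(1) J(2), of I])
          show "N' \<subseteq> {p + i |p i. p \<in> P \<and> i \<in> I}"
            using add.prems(2) by (auto simp: N'_def)
          show "N' \<inter> P \<subseteq> J"
            using N'P right_ideal_zero[OF J(1)] by blast
        qed (use 2 in blast)
        thus ?thesis by simp
      qed
    qed
    thus ?thesis
      using N' unfolding minimal_right_ideal_def by blast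
  qed
  then obtain f where f: "f * f = f" "N' = range ((*) f)"
  proof
    assume "N' = {0}"
    thus ?thesis using that[of 0] by auto
  next
    assume "minimal_right_ideal N'"
    thus ?thesis using minimal_right_ideal_idempotent[OF sp] that by blast
  qed
  have fN': "f \<in> N'"
    using f(2) by (metis mult_1_right rangeI)
  hence ef: "e * f = 0" and fN: "f \<in> N" by (auto simp: N'_def)
  have eff: "e * (f * z) = 0" "e * (e * z) = e * z" "f * (f * z) = f * z" for z
    using ef e f by (simp_all flip: mult.assoc)
  \<comment> \<open>Only \<open>e * f = 0\<close> is known. The correction \<open>- f * e\<close>
    gives \<open>g * e = e\<close> and \<open>g * f = f\<close>, so \<open>g\<close> fixes
    \<open>eA\<close> and \<open>fA\<close> pointwise.\<close>
  define g where "g = e + f - f * e"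
  have gg: "g * g = g"
    by (simp add: g_def algebra_simps ef e f eff)
  have "N = range ((*) g)"
  proof
    have "g \<in> N"
      unfolding g_def using add.prems(1) eN fN
      by (intro right_ideal_diff right_ideal_add right_ideal_mult) auto
    thus "range ((*) g) \<subseteq> N"
      using right_ideal_mult[OF add.prems(1)] by blast
    show "N \<subseteq> range ((*) g)"
    proof
      fix z assume z: "z \<in> N"
      have "z - e * z \<in> N"
        using z eN add.prems(1) by (intro right_ideal_diff right_ideal_mult) auto
      hence "z - e * z \<in> N'"
        by (simp add: N'_def algebra_simps eff)
      then obtain c where "z - e * z = f * c"
        using f(2) by blast
      hence "z = e * z + f * c" by (simp add: algebra_simps)
      moreover have "g * (e * z + f * c) = e * z + f * c"
        by (simp add: g_def algebra_simps eff)
      ultimately have "g * z = z" by simp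
      thus "z \<in> range ((*) g)" by (metis rangeI)
    qed
  qed
  thus ?case using gg by blast
qed

section \<open>Von Neumann regularity modulo the socle\<close>

lemma soc_regular:
  fixes s :: "'a::complex_banach_algebra_1"
  assumes "semiprime_algebra TYPE('a)" "s \<in> soc"
  shows "\<exists>c. s * c * s = s"
proof -
  obtain P where P: "finite_minimal_sum P" "s \<in> P"
    using soc_in_finite_minimal_sum[OF assms(2)] by blast
  have "range ((*) s) \<subseteq> P"
    using right_ideal_mult[OF finite_minimal_sum_right_ideal[OF P(1)] P(2)] by blast
  then obtain e where e: "e * e = e" "range ((*) s) = range ((*) e)"
    using finite_minimal_sum_idempotent[OF assms(1) P(1) right_ideal_range_mult] by blast
  obtain c where c: "e = s * c"
    using e(2) by (metis imageE mult_1_right rangeI)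
  obtain d where d: "s = e * d"
    using e(2) by (metis imageE mult_1_right rangeI)
  \<comment> \<open>From \<open>e = s * c\<close> and \<open>s = e * d\<close> follows
    \<open>s * c * s = e * e * d = s\<close>.\<close>
  have "s * c * s = s"
    using c d e(1) by (metis mult.assoc)
  thus ?thesis by blast
qed

text \<open>The defect \<open>s\<close> is both \<open>a * (1 - c * a)\<close> and
  \<open>(1 - a * c) * a\<close>, so a generalised inverse \<open>d\<close> of \<open>s\<close>
  corrects \<open>c\<close> to the generalised inverse
  \<open>c + (1 - c * a) * d * (1 - a * c)\<close> of \<open>a\<close>.\<close>

lemma regular_mod_soc:
  fixes a :: "'a::complex_banach_algebra_1"
  assumes "semiprime_algebra TYPE('a)" "a - a * c * a \<in> soc"
  shows "\<exists>d. a * d * a = a"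
proof -
  define s where "s = a - a * c * a"
  obtain d where d: "s * d * s = s"
    using soc_regular assms unfolding s_def by blast
  have "a * (c + (1 - c * a) * d * (1 - a * c)) * a = a * c * a + s * d * s"
    by (simp add: s_def algebra_simps)
  also have "\<dots> = a" by (simp add: d) (simp add: s_def)
  finally show ?thesis by blast
qed

text \<open>Modulo the socle a representative \<open>b\<close> of the Drazin inverse commutes with
  \<open>y\<close>, hence with its powers, so in \<open>y^k = y^k b y\<close> the factor
  \<open>b\<close> can be moved to either end.\<close>

lemma B_Fredholm_power_mod_soc:
  fixes y :: "'a::complex_banach_algebra_1"
  assumes "B_Fredholm y"
  obtains b k where "y ^ k - b * y ^ Suc k \<in> soc" "y ^ k - y ^ Suc k * b \<in> soc"
proof -
  interpret ideal "soc :: 'a set" alg_ring by (rule ideal_soc)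
  let ?Q = "alg_ring Quot (soc :: 'a set)" and ?h = "\<lambda>a::'a. soc +>\<^bsub>alg_ring\<^esub> a"
  interpret h: ring_hom_ring alg_ring ?Q ?h by (rule rcos_ring_hom_ring)
  obtain B k where B: "B \<in> carrier ?Q" "?h y \<otimes>\<^bsub>?Q\<^esub> B = B \<otimes>\<^bsub>?Q\<^esub> ?h y"
    "?h y [^]\<^bsub>?Q\<^esub> k \<otimes>\<^bsub>?Q\<^esub> B \<otimes>\<^bsub>?Q\<^esub> ?h y = ?h y [^]\<^bsub>?Q\<^esub> (k::nat)"
    using assms unfolding B_Fredholm_def drazin_invertible_def by blast
  obtain b where b: "B = ?h b"
    using B(1) by (auto simp: FactRing_def A_RCOSETS_def' )
  have pow: "?h y [^]\<^bsub>?Q\<^esub> (n::nat) = ?h (y ^ n)" for n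
  proof (induction n)
    case 0
    show ?case using h.hom_one by simp
  next
    case (Suc n)
    thus ?case using h.hom_mult[of "y ^ n" y] by (simp add: power_commutes)
  qed
  have eq: "a - a' \<in> soc" if "?h a = ?h a'" for a a'
    using that quotient_eq_iff_same_a_r_cos[OF ideal_soc, of a a']
    by (simp add: a_minus_def)
  have "?h (y * b) = ?h (b * y)" "?h (y ^ k * b * y) = ?h (y ^ k)"
    using B(2,3) h.hom_mult by (simp_all add: b pow)
  hence comm: "y * b - b * y \<in> soc" and k: "y ^ k * b * y - y ^ k \<in> soc"
    by (auto intro: eq)
  have comm_pow: "y ^ i * b - b * y ^ i \<in> soc" for i
  proof (induction i)
    case (Suc i)
    have "y ^ Suc i * b - b * y ^ Suc i = y * (y ^ i * b - b * y ^ i) + (y * b - b * y) * y ^ i"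
      by (simp add: algebra_simps)
    thus ?case
      using soc_add[OF soc_mult_left[OF Suc] soc_mult_right[OF comm]] by simp
  qed (simp add: soc_zero)
  have "y ^ k - b * y ^ Suc k = (y ^ k * b - b * y ^ k) * y - (y ^ k * b * y - y ^ k)"
    by (simp only: power_Suc2) (simp add: algebra_simps)
  moreover have "y ^ k - y ^ Suc k * b = - (y ^ k * (y * b - b * y)) - (y ^ k * b * y - y ^ k)"
    by (simp only: power_Suc2) (simp add: algebra_simps)
  moreover have "(y ^ k * b - b * y ^ k) * y - (y ^ k * b * y - y ^ k) \<in> soc"
    by (intro soc_diff soc_mult_right comm_pow k)
  moreover have "0 - y ^ k * (y * b - b * y) - (y ^ k * b * y - y ^ k) \<in> soc"
    by (intro soc_diff soc_mult_left comm k soc_zero)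
  ultimately show ?thesis
    using that by (metis diff_0)
qed

text \<open>Modulo the socle, \<open>q = y^j\<close> and \<open>c = b^j\<close> satisfy
  \<open>q = c q^2 = q^2 c\<close>. Hence \<open>c q = c q^2 c = q c\<close> and
  \<open>q c q = c q^2 = q\<close>, and regularity modulo the socle lifts to regularity of
  \<open>y^j\<close>.\<close>

lemma regular_power:
  fixes y :: "'a::complex_banach_algebra_1"
  assumes sp: "semiprime_algebra TYPE('a)"
    and l: "y ^ k - b * y ^ Suc k \<in> soc" and r: "y ^ k - y ^ Suc k * b \<in> soc" and "j \<ge> k"
  shows "\<exists>d. y ^ j * d * y ^ j = y ^ j"
proof -
  have l1: "y ^ i - b * y ^ Suc i \<in> soc" and r1: "y ^ i - y ^ Suc i * b \<in> soc" if ik: "i \<ge> k" for i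
  proof -
    obtain t where t: "i = k + t" using le_Suc_ex[OF ik] by blast
    have "y ^ i - b * y ^ Suc i = (y ^ k - b * y ^ Suc k) * y ^ t"
      by (simp add: t power_add algebra_simps)
    thus "y ^ i - b * y ^ Suc i \<in> soc" using soc_mult_right[OF l] by simp
    have "y ^ i - y ^ Suc i * b = y ^ t * (y ^ k - y ^ Suc k * b)"
      by (simp only: t add.commute[of k t] power_Suc2 power_add) (simp add: algebra_simps)
    thus "y ^ i - y ^ Suc i * b \<in> soc" using soc_mult_left[OF r] by simp
  qed
  have l2: "y ^ j - b ^ i * y ^ (j + i) \<in> soc" for i
  proof (induction i)
    case (Suc i)
    have "y ^ j - b ^ Suc i * y ^ (j + Suc i) =
        (y ^ j - b ^ i * y ^ (j + i)) + b ^ i * (y ^ (j + i) - b * y ^ Suc (j + i))"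
      by (simp only: power_Suc2[of b] add_Suc_right) (simp add: algebra_simps del: power_Suc)
    also have "\<dots> \<in> soc"
      by (intro soc_add Suc soc_mult_left l1) (use \<open>j \<ge> k\<close> in simp)
    finally show ?case .
  qed (simp add: soc_zero)
  have r2: "y ^ j - y ^ (j + i) * b ^ i \<in> soc" for i
  proof (induction i)
    case (Suc i)
    have "y ^ j - y ^ (j + Suc i) * b ^ Suc i =
        (y ^ j - y ^ (j + i) * b ^ i) + (y ^ (j + i) - y ^ Suc (j + i) * b) * b ^ i"
      by (simp add: algebra_simps)
    also have "\<dots> \<in> soc"
      by (intro soc_add Suc soc_mult_right r1) (use \<open>j \<ge> k\<close> in simp)
    finally show ?case .
  qed (simp add: soc_zero)
  define q c where "q = y ^ j" and "c = b ^ j"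
  have ql: "q - c * (q * q) \<in> soc" and qr: "q - q * q * c \<in> soc"
    using l2[of j] r2[of j] by (simp_all add: q_def c_def power_add)
  have "q - q * c * q =
      (q - c * (q * q)) - ((q - c * (q * q)) * c - c * (q - q * q * c)) * q"
    by (simp add: algebra_simps)
  moreover have "\<dots> \<in> soc"
    by (intro soc_diff soc_mult_right soc_mult_left ql qr)
  ultimately show ?thesis
    using regular_mod_soc[OF sp] by (metis q_def)
qed

section \<open>The ascent and left invertibility near a B-Fredholm point\<close>

interpretation complex_vector: vector_space "scaleC :: complex \<Rightarrow> 'a \<Rightarrow> 'a::complex_banach_algebra_1"
  by unfold_locales (simp_all add: scaleC_add_right scaleC_add_left scaleC_scaleC scaleC_one)

section \<open>The ascent through annihilators of powers\<close>

lemma p_l_finite_iff: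
  "p_l y < \<infinity> \<longleftrightarrow> (\<exists>n. right_annihilator (y ^ n) = right_annihilator (y ^ Suc n))"
proof
  assume "p_l y < \<infinity>"
  hence "{enat n |n. right_annihilator (y ^ n) = right_annihilator (y ^ (n + 1))} \<noteq> {}"
    unfolding p_l_def by (metis Inf_empty infinity_enat_def less_irrefl top_enat_def)
  thus "\<exists>n. right_annihilator (y ^ n) = right_annihilator (y ^ Suc n)" by auto
next
  assume "\<exists>n. right_annihilator (y ^ n) = right_annihilator (y ^ Suc n)"
  then obtain n where "right_annihilator (y ^ n) = right_annihilator (y ^ (n + 1))" by auto
  hence "p_l y \<le> enat n"
    unfolding p_l_def by (intro Inf_lower) auto
  thus "p_l y < \<infinity>" using le_less_trans by fastforce
qed

lemma right_annihilator_power_stable: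
  assumes "right_annihilator (y ^ n) = right_annihilator (y ^ Suc n)" "n \<le> m"
  shows "right_annihilator (y ^ m) = right_annihilator (y ^ Suc m)"
  using assms(2)
proof (induction m rule: dec_induct)
  case (step m)
  have "a \<in> right_annihilator (y ^ Suc i) \<longleftrightarrow> y * a \<in> right_annihilator (y ^ i)" for a i
    by (simp only: right_annihilator_def power_Suc2 mult.assoc mem_Collect_eq)
  thus ?case
    using step.IH by blast
qed (use assms in auto)

lemma neumann_series:
  fixes x :: "'a::{real_normed_algebra_1, banach}"
  assumes "norm x < 1"
  obtains g where "(\<lambda>n. x ^ n) sums g" "g * (1 - x) = 1" "(1 - x) * g = 1"
    "norm g \<le> 1 / (1 - norm x)"
proof -
  define g where "g = (\<Sum>n. x ^ n)"
  have s: "summable (\<lambda>n. x ^ n)"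
    by (rule complete_algebra_summable_geometric[OF assms])
  hence sums: "(\<lambda>n. x ^ n) sums g"
    unfolding g_def by (rule summable_sums)
  have "(\<lambda>n. x ^ Suc n) sums (g - 1)"
    using sums by (subst sums_Suc_iff) simp
  moreover have "(\<lambda>n. x ^ Suc n) sums (x * g)"
    using sums_mult[OF sums, of x] by simp
  moreover have "(\<lambda>n. x ^ Suc n) sums (g * x)"
    using sums_mult2[OF sums, of x] by (simp add: power_commutes)
  ultimately have eq: "g - 1 = x * g" "g - 1 = g * x"
    using sums_unique2 by blast+
  have "norm g \<le> norm (1::'a) + norm (x * g)"
    using eq(1) by (metis add.commute diff_add_cancel norm_triangle_ineq)
  also have "\<dots> \<le> 1 + norm x * norm g"
    by (simp add: norm_mult_ineq)
  finally have "norm g * (1 - norm x) \<le> 1"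
    by (simp add: algebra_simps)
  hence "norm g \<le> 1 / (1 - norm x)"
    using assms by (simp add: pos_le_divide_eq)
  moreover have "g * (1 - x) = 1" "(1 - x) * g = 1"
    using eq by (simp_all add: algebra_simps)
  ultimately show ?thesis using that sums by blast
qed

section \<open>Left inverses of small nonzero shifts\<close>

lemma scaleC_eq_mult: "z *\<^sub>C a = (z *\<^sub>C 1) * (a::'a::complex_banach_algebra_1)"
  by (simp add: mult_scaleC_left)

text \<open>The factor theorem with \<open>y - z\<close> on the right; the quotient for
  \<open>n + 1\<close> is \<open>y^n + z v\<close>, where \<open>v\<close> is the one for
  \<open>n\<close>.\<close>

lemma shift_dvd_power_diff:
  "\<exists>v. v * shift y z = y ^ n - z ^ n *\<^sub>C (1::'a::complex_banach_algebra_1)"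
proof (induction n)
  case (Suc n)
  then obtain v where v: "v * shift y z = y ^ n - z ^ n *\<^sub>C 1" by blast
  have "(y ^ n + z *\<^sub>C v) * shift y z = y ^ n * shift y z + z *\<^sub>C (v * shift y z)"
    by (simp add: distrib_right mult_scaleC_left)
  also have "\<dots> = y ^ Suc n - z ^ Suc n *\<^sub>C 1"
    by (simp add: v) (simp add: shift_def right_diff_distrib mult_scaleC_right
        complex_vector.scale_right_diff_distrib scaleC_scaleC power_commutes)
  finally show ?case by blast
qed (auto simp: scaleC_one intro: exI[of _ 0])

lemma left_invertible_shift:
  fixes y w :: "'a::complex_banach_algebra_1"
  assumes w: "w * y ^ Suc n = y ^ n" and "z \<noteq> 0" "cmod z * norm w < 1"
  shows "left_invertible (shift y z)"
proof -
  have "norm (z *\<^sub>C w) < 1"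
    using assms(3) by (simp add: norm_scaleC)
  then obtain g where g: "g * (1 - z *\<^sub>C w) = 1"
    using neumann_series by metis
  obtain v where v: "v * shift y z = y ^ n - z ^ n *\<^sub>C 1"
    using shift_dvd_power_diff by blast
  have "w * y ^ n * shift y z = (1 - z *\<^sub>C w) * y ^ n"
    using w by (simp add: shift_def right_diff_distrib left_diff_distrib mult_scaleC_right
        mult_scaleC_left power_commutes mult.assoc)
  hence "g * w * y ^ n * shift y z = y ^ n"
    using g by (metis mult.assoc mult_1_left)
  \<comment> \<open>Subtracting \<open>v * shift y z\<close> cancels \<open>y^n\<close> and leaves
    the scalar \<open>z^n\<close>, which is invertible because \<open>z \<noteq> 0\<close>.\<close>
  hence "(g * w * y ^ n - v) * shift y z = z ^ n *\<^sub>C 1"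
    using v by (simp add: left_diff_distrib)
  hence "(inverse (z ^ n) *\<^sub>C (g * w * y ^ n - v)) * shift y z = 1"
    using \<open>z \<noteq> 0\<close> by (simp add: mult_scaleC_left scaleC_scaleC scaleC_one)
  thus ?thesis unfolding left_invertible_def by blast
qed

lemma left_invertible_punctured_neighbourhood:
  fixes y :: "'a::complex_banach_algebra_1"
  assumes sp: "semiprime_algebra TYPE('a)" and "B_Fredholm y" "p_l y < \<infinity>"
  shows "\<exists>e>0. \<forall>z. z \<noteq> 0 \<and> cmod z < e \<longrightarrow> left_invertible (shift y z)"
proof -
  obtain b k where bk: "y ^ k - b * y ^ Suc k \<in> soc" "y ^ k - y ^ Suc k * b \<in> soc"
    using B_Fredholm_power_mod_soc[OF assms(2)] .
  obtain n0 where n0: "right_annihilator (y ^ n0) = right_annihilator (y ^ Suc n0)"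
    using assms(3) p_l_finite_iff by blast
  define n where "n = max n0 k"
  have n: "right_annihilator (y ^ n) = right_annihilator (y ^ Suc n)"
    by (rule right_annihilator_power_stable[OF n0]) (simp add: n_def)
  obtain c where c: "y ^ Suc n * c * y ^ Suc n = y ^ Suc n"
    using regular_power[OF sp bk, of "Suc n"] unfolding n_def by (metis le_SucI max.cobounded2)
  \<comment> \<open>Regularity says that \<open>y^(n + 1)\<close> kills
    \<open>c y^(n + 1) - 1\<close>. As the annihilators have stabilised, \<open>y^n\<close> kills it
    too, so \<open>w = y^n c\<close> has the relation required by
    \<open>left_invertible_shift\<close>.\<close>
  hence "c * y ^ Suc n - 1 \<in> right_annihilator (y ^ Suc n)"
    by (simp add: right_annihilator_def right_diff_distrib mult.assoc[symmetric] del: power_Suc)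
  hence "c * y ^ Suc n - 1 \<in> right_annihilator (y ^ n)"
    using n by simp
  hence w: "(y ^ n * c) * y ^ Suc n = y ^ n"
    by (simp add: right_annihilator_def right_diff_distrib mult.assoc[symmetric] del: power_Suc)
  show ?thesis
  proof (intro exI[of _ "1 / (norm (y ^ n * c) + 1)"] conjI allI impI)
    show "0 < 1 / (norm (y ^ n * c) + 1)"
      by (simp add: add_nonneg_pos)
    fix z assume z: "z \<noteq> 0 \<and> cmod z < 1 / (norm (y ^ n * c) + 1)"
    have "cmod z * norm (y ^ n * c) \<le> cmod z * (norm (y ^ n * c) + 1)"
      by (intro mult_left_mono) auto
    also have "\<dots> < 1"
      using z by (simp add: pos_less_divide_eq add_nonneg_pos)
    finally show "left_invertible (shift y z)"
      using left_invertible_shift[OF w] z by blast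
  qed
qed

text \<open>The right ideals \<open>R(y) \<inter> y^j A\<close> eventually lie in a finite sum of minimal right ideals,
  so they stabilise, at a nonzero right ideal because the ascent is infinite. Hence they are
  eventually contained in \<open>M = \<Inter>j. y^j A\<close>, and \<open>w = y^m c\<close>, with \<open>c\<close> a generalised inverse of
  \<open>y^(m + 1)\<close>, maps \<open>M\<close> into itself and is a right inverse of \<open>y\<close> on \<open>M\<close>.\<close>

lemma eigenvector_chain:
  fixes y :: "'a::complex_banach_algebra_1"
  assumes sp: "semiprime_algebra TYPE('a)" and "B_Fredholm y" "p_l y = \<infinity>"
  obtains g w where "g \<noteq> 0" "y * g = 0" "\<And>i. y * (w ^ Suc i * g) = w ^ i * g"
proof -
  obtain b k where bk: "y ^ k - b * y ^ Suc k \<in> soc" "y ^ k - y ^ Suc k * b \<in> soc"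
    using B_Fredholm_power_mod_soc[OF assms(2)] .
  define K where "K j = right_annihilator y \<inter> range ((*) (y ^ j))" for j
  have range_mono: "range ((*) (y ^ j)) \<subseteq> range ((*) (y ^ i))" if ij: "i \<le> j" for i j
  proof -
    obtain t where "j = i + t" using le_Suc_ex[OF ij] by blast
    thus ?thesis by (auto simp: power_add mult.assoc)
  qed
  obtain P where P: "finite_minimal_sum P" "y ^ k - b * y ^ Suc k \<in> P"
    using soc_in_finite_minimal_sum[OF bk(1)] by blast
  \<comment> \<open>If \<open>a = y^k c\<close> and \<open>y a = 0\<close>, the term
    \<open>b y^(k + 1) c\<close> vanishes, so \<open>a\<close> is the chosen socle element times
    \<open>c\<close>.\<close>
  have "K k \<subseteq> P"
  proof
    fix a assume "a \<in> K k"
    then obtain c where c: "a = y ^ k * c" "y * a = 0"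
      by (auto simp: K_def right_annihilator_def)
    hence "a = (y ^ k - b * y ^ Suc k) * c"
      by (simp add: left_diff_distrib mult.assoc)
    thus "a \<in> P"
      using right_ideal_mult[OF finite_minimal_sum_right_ideal[OF P(1)] P(2)] by simp
  qed
  moreover have K_mono: "K j \<subseteq> K i" if "i \<le> j" for i j
    unfolding K_def using range_mono[OF that] by blast
  ultimately have "\<exists>m. \<forall>j\<ge>m. K (k + j) = K (k + m)"
  proof (intro finite_minimal_sum_dcc[OF P(1)])
    show "right_ideal (K (k + j))" for j
      unfolding K_def
      by (intro right_ideal_Int right_ideal_right_annihilator right_ideal_range_mult)
    show "K (k + j) \<subseteq> P" for j
      using K_mono[of k "k + j"] \<open>K k \<subseteq> P\<close> by simp
  qed (auto simp: decseq_def intro!: K_mono)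
  then obtain m' where m': "\<forall>j\<ge>m'. K (k + j) = K (k + m')" by blast
  define m where "m = k + m'"
  have m: "K j = K m" if "j \<ge> m" for j
    using m'[rule_format, of "j - k"] that by (simp add: m_def)
  obtain c where c: "y ^ Suc m * c * y ^ Suc m = y ^ Suc m"
    using regular_power[OF sp bk, of "Suc m"] unfolding m_def by (metis le_SucI le_add1)
  define w where "w = y ^ m * c"
  define M where "M = (\<Inter>j. range ((*) (y ^ j)))"
  have KM: "K m \<subseteq> M"
  proof -
    have "K m \<subseteq> range ((*) (y ^ j))" for j
      using m[of "max j m"] range_mono[of j "max j m"] by (auto simp: K_def)
    thus ?thesis by (auto simp: M_def)
  qed
  have yw: "y * (w * g) = g" if "g \<in> M" for g
  proof -
    have "g \<in> range ((*) (y ^ Suc m))" using that unfolding M_def by blast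
    then obtain a where "g = y ^ Suc m * a" by blast
    thus ?thesis using c by (simp add: w_def mult.assoc[symmetric])
  qed
  have wM: "w * g \<in> M" if g: "g \<in> M" for g
    unfolding M_def
  proof
    fix j
    \<comment> \<open>As \<open>n \<ge> m\<close>, the difference \<open>w g - y^n a\<close>, killed
      by \<open>y\<close> and lying in \<open>y^m A\<close>, belongs to \<open>K m = K n\<close> and
      hence to \<open>y^n A\<close>.\<close>
    define n where "n = max j m"
    have "g \<in> range ((*) (y ^ Suc n))" using g unfolding M_def by blast
    then obtain a where a: "g = y ^ Suc n * a" by blast
    have "y * (w * g - y ^ n * a) = 0"
      using yw[OF g] a by (simp add: right_diff_distrib mult.assoc)
    moreover have "w * g - y ^ n * a \<in> range ((*) (y ^ m))"
    proof (rule right_ideal_diff[OF right_ideal_range_mult])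
      show "w * g \<in> range ((*) (y ^ m))" unfolding w_def mult.assoc by blast
      show "y ^ n * a \<in> range ((*) (y ^ m))" using range_mono[of m n] unfolding n_def by auto
    qed
    ultimately have "w * g - y ^ n * a \<in> K n"
      using m[of n] by (simp add: K_def right_annihilator_def n_def)
    hence "w * g - y ^ n * a \<in> range ((*) (y ^ n))" unfolding K_def by blast
    from right_ideal_add[OF right_ideal_range_mult this, of "y ^ n * a"]
    have "w * g \<in> range ((*) (y ^ n))" by simp
    thus "w * g \<in> range ((*) (y ^ j))"
      using range_mono[of j n] unfolding n_def by auto
  qed
  \<comment> \<open>Infinite ascent makes \<open>K m\<close> nonzero: an \<open>a\<close> killed by
    \<open>y^(m + 1)\<close> but not by \<open>y^m\<close> yields \<open>g = y^m a\<close>.\<close>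
  have "right_annihilator (y ^ m) \<noteq> right_annihilator (y ^ Suc m)"
    using assms(3) p_l_finite_iff[of y] by auto
  moreover have "right_annihilator (y ^ m) \<subseteq> right_annihilator (y ^ Suc m)"
    by (auto simp: right_annihilator_def mult.assoc)
  ultimately obtain a where a: "y ^ Suc m * a = 0" "y ^ m * a \<noteq> 0"
    by (auto simp: right_annihilator_def)
  define g where "g = y ^ m * a"
  have gK: "g \<in> K m"
    using a by (simp add: K_def g_def right_annihilator_def mult.assoc)
  have wg: "w ^ i * g \<in> M" for i
  proof (induction i)
    case (Suc i)
    thus ?case using wM[of "w ^ i * g"] by (simp add: mult.assoc)
  qed (use gK KM in auto)
  show ?thesis
  proof
    show "g \<noteq> 0" using a by (simp add: g_def)
    show "y * g = 0" using gK by (simp add: K_def right_annihilator_def)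
    show "y * (w ^ Suc i * g) = w ^ i * g" for i
      using yw[OF wg[of i]] by (simp add: mult.assoc)
  qed
qed

section \<open>The Hahn-Banach theorem and the identity theorem\<close>

definition sublinear :: "('b::real_vector \<Rightarrow> real) \<Rightarrow> bool" where
  "sublinear p \<longleftrightarrow> (\<forall>x y. p (x + y) \<le> p x + p y) \<and> (\<forall>t\<ge>0. \<forall>x. p (t *\<^sub>R x) = t * p x)"

lemma sublinear_add: "sublinear p \<Longrightarrow> p (x + y) \<le> p x + p y"
  and sublinear_scaleR: "sublinear p \<Longrightarrow> 0 \<le> t \<Longrightarrow> p (t *\<^sub>R x) = t * p x"
  by (auto simp: sublinear_def)

lemma sublinearI:
  assumes add: "\<And>x y. p (x + y) \<le> p x + p y"
    and zero: "p 0 = 0" and scale: "\<And>t x. t > 0 \<Longrightarrow> p (t *\<^sub>R x) \<le> t * p x"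
  shows "sublinear p"
  unfolding sublinear_def
proof (intro conjI allI impI add)
  fix t :: real and x assume "t \<ge> 0"
  show "p (t *\<^sub>R x) = t * p x"
  proof (cases "t = 0")
    case False
    with \<open>t \<ge> 0\<close> have t: "t > 0" by simp
    have "p x \<le> inverse t * p (t *\<^sub>R x)"
      using scale[of "inverse t" "t *\<^sub>R x"] t by simp
    hence "t * p x \<le> p (t *\<^sub>R x)"
      using t by (simp add: field_simps)
    thus ?thesis using scale[OF t, of x] by simp
  qed (simp add: zero)
qed

lemma sublinear_zero: "sublinear p \<Longrightarrow> p 0 = 0"
  using sublinear_scaleR[of p 0 0] by simp

lemma sublinear_ge_neg: "sublinear p \<Longrightarrow> - p (- x) \<le> p x"
  using sublinear_add[of p x "- x"] sublinear_zero[of p] by simp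

lemma cINF_add_bound:
  fixes f :: "'b \<Rightarrow> real" and g :: "'c \<Rightarrow> real"
  assumes "A \<noteq> {}" "B \<noteq> {}" "\<And>a b. a \<in> A \<Longrightarrow> b \<in> B \<Longrightarrow> u \<le> f a + g b"
  shows "u \<le> (INF a\<in>A. f a) + (INF b\<in>B. g b)"
proof -
  have "u - f a \<le> (INF b\<in>B. g b)" if "a \<in> A" for a
    using assms that by (intro cINF_greatest) (auto simp: algebra_simps)
  hence "u - (INF b\<in>B. g b) \<le> (INF a\<in>A. f a)"
    using assms(1) by (intro cINF_greatest) (auto simp: algebra_simps)
  thus ?thesis by simp
qed

text \<open>The auxiliary functional of the Hahn-Banach proof: for sublinear \<open>p\<close> it
  lies below \<open>p\<close> (take \<open>t = 0\<close>) and is at most \<open>- p v\<close> at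
  \<open>- v\<close> (take \<open>t = 1\<close>).\<close>

definition slope_inf :: "'b::real_vector \<Rightarrow> ('b \<Rightarrow> real) \<Rightarrow> 'b \<Rightarrow> real" where
  "slope_inf v p x = (INF t\<in>{0..}. p (x + t *\<^sub>R v) - t * p v)"

lemma slope_inf_le:
  assumes "sublinear p" "0 \<le> t"
  shows "slope_inf v p x \<le> p (x + t *\<^sub>R v) - t * p v"
  unfolding slope_inf_def
proof (rule cINF_lower)
  \<comment> \<open>The lower bound comes from
    \<open>s p v = p (s v) \<le> p (x + s v) + p (- x)\<close>.\<close>
  show "bdd_below ((\<lambda>t. p (x + t *\<^sub>R v) - t * p v) ` {0..})"
  proof (rule bdd_belowI2)
    fix s :: real assume "s \<in> {0..}"
    thus "- p (- x) \<le> p (x + s *\<^sub>R v) - s * p v"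
      using sublinear_add[OF assms(1), of "x + s *\<^sub>R v" "- x"] sublinear_scaleR[OF assms(1), of s v]
      by simp
  qed
qed (use assms in simp)

lemma sublinear_slope_inf:
  assumes p: "sublinear p"
  shows "sublinear (slope_inf v p)"
proof (rule sublinearI)
  show "slope_inf v p (x + y) \<le> slope_inf v p x + slope_inf v p y" for x y
    unfolding slope_inf_def[of v p x] slope_inf_def[of v p y]
  proof (rule cINF_add_bound)
    fix s t :: real assume "s \<in> {0..}" "t \<in> {0..}"
    hence "slope_inf v p (x + y) \<le> p ((x + y) + (s + t) *\<^sub>R v) - (s + t) * p v"
      by (intro slope_inf_le[OF p]) auto
    also have "(x + y) + (s + t) *\<^sub>R v = (x + s *\<^sub>R v) + (y + t *\<^sub>R v)"
      by (simp add: algebra_simps)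
    also have "p \<dots> \<le> p (x + s *\<^sub>R v) + p (y + t *\<^sub>R v)"
      by (rule sublinear_add[OF p])
    finally show "slope_inf v p (x + y) \<le>
        (p (x + s *\<^sub>R v) - s * p v) + (p (y + t *\<^sub>R v) - t * p v)"
      by (simp add: algebra_simps)
  qed auto
  show "slope_inf v p 0 = 0"
    using sublinear_scaleR[OF p] by (simp add: slope_inf_def)
  fix c :: real and x assume c: "c > 0"
  have "slope_inf v p (c *\<^sub>R x) / c \<le> slope_inf v p x"
    unfolding slope_inf_def[of v p x]
  proof (rule cINF_greatest)
    fix t :: real assume "t \<in> {0..}"
    hence "slope_inf v p (c *\<^sub>R x) \<le> p (c *\<^sub>R x + (c * t) *\<^sub>R v) - (c * t) * p v"
      using c by (intro slope_inf_le[OF p]) auto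
    also have "c *\<^sub>R x + (c * t) *\<^sub>R v = c *\<^sub>R (x + t *\<^sub>R v)"
      by (simp add: algebra_simps)
    also have "p \<dots> = c * p (x + t *\<^sub>R v)"
      using c by (intro sublinear_scaleR[OF p]) simp
    finally have "slope_inf v p (c *\<^sub>R x) \<le> c * (p (x + t *\<^sub>R v) - t * p v)"
      by (simp add: right_diff_distrib mult.assoc)
    thus "slope_inf v p (c *\<^sub>R x) / c \<le> p (x + t *\<^sub>R v) - t * p v"
      by (simp add: pos_divide_le_eq[OF c] mult.commute)
  qed simp
  thus "slope_inf v p (c *\<^sub>R x) \<le> c * slope_inf v p x"
    by (simp add: pos_divide_le_eq[OF c] mult.commute)
qed

text \<open>Zorn's lemma for the reversed pointwise order. The infimum of a chain is finite because
  each member is at least \<open>- p0 (- x)\<close> at \<open>x\<close>, and subadditive because any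
  two members can be replaced by the smaller one.\<close>

lemma exists_minimal_sublinear:
  assumes p0: "sublinear p0"
  obtains q where "sublinear q" "q \<le> p0" "\<And>p. sublinear p \<Longrightarrow> p \<le> q \<Longrightarrow> p = q"
proof -
  define A where "A = {p. sublinear p \<and> p \<le> p0}"
  have "\<exists>m\<in>A. \<forall>a\<in>A. m \<ge> a \<longrightarrow> a = m"
  proof (rule predicate_Zorn)
    show "partial_order_on A (relation_of (\<ge>) A)"
      by (rule partial_order_on_relation_ofI) auto
    fix C assume "C \<in> Chains (relation_of (\<ge>) A)"
    hence CA: "C \<subseteq> A" and ch: "\<And>p q. p \<in> C \<Longrightarrow> q \<in> C \<Longrightarrow> p \<le> q \<or> q \<le> p"
      by (auto simp: Chains_def relation_of_def)
    show "\<exists>u\<in>A. \<forall>a\<in>C. a \<ge> u"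
    proof (cases "C = {}")
      case True
      thus ?thesis using p0 by (auto simp: A_def)
    next
      case False
      define u where "u x = (INF p\<in>C. p x)" for x
      have lower: "u x \<le> p x" if "p \<in> C" for p x
        unfolding u_def
      proof (rule cINF_lower[OF _ that], rule bdd_belowI2)
        fix q assume "q \<in> C"
        hence "sublinear q" "q (- x) \<le> p0 (- x)"
          using CA by (auto simp: A_def le_fun_def)
        thus "- p0 (- x) \<le> q x"
          using sublinear_ge_neg[of q x] by simp
      qed
      have sub: "sublinear p" if "p \<in> C" for p
        using CA that by (auto simp: A_def)
      have "sublinear u"
      proof (rule sublinearI)
        fix x y
        show "u (x + y) \<le> u x + u y"
          unfolding u_def[of x] u_def[of y]
        proof (rule cINF_add_bound[OF False False])
          fix p q assume pq: "p \<in> C" "q \<in> C"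
          then obtain r where r: "r \<in> C" "r \<le> p" "r \<le> q"
            using ch by blast
          have "u (x + y) \<le> r x + r y"
            using lower[OF r(1), of "x + y"] sublinear_add[OF sub[OF r(1)], of x y] by simp
          thus "u (x + y) \<le> p x + q y"
            using r(2,3) by (meson add_mono le_funD order_trans)
        qed
      next
        show "u 0 = 0"
          unfolding u_def using False by (simp add: sublinear_zero sub cong: INF_cong)
      next
        fix t :: real and x assume t: "t > 0"
        have "inverse t * u (t *\<^sub>R x) \<le> u x"
          unfolding u_def[of x]
        proof (rule cINF_greatest[OF False])
          fix p assume p: "p \<in> C"
          have "u (t *\<^sub>R x) \<le> t * p x"
            using lower[OF p, of "t *\<^sub>R x"] sublinear_scaleR[OF sub[OF p], of t x] t by simp
          thus "inverse t * u (t *\<^sub>R x) \<le> p x"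
            using t by (simp add: field_simps)
        qed
        thus "u (t *\<^sub>R x) \<le> t * u x"
          using t by (simp add: field_simps)
      qed
      moreover obtain p where p: "p \<in> C" using False by blast
      have "u \<le> p0"
      proof (rule le_funI)
        fix x
        have "p x \<le> p0 x" using p CA by (auto simp: A_def le_fun_def)
        thus "u x \<le> p0 x" using lower[OF p, of x] by simp
      qed
      ultimately have "u \<in> A" by (simp add: A_def)
      thus ?thesis using lower by (auto simp: le_fun_def)
    qed
  qed
  thus ?thesis using that by (fastforce simp: A_def)
qed

text \<open>Hahn-Banach: a minimal sublinear functional \<open>q\<close> is linear, because it equals
  \<^term>\<open>slope_inf v q\<close> for every \<open>v\<close>.\<close>

lemma exists_bounded_linear_nonzero:
  fixes v :: "'b::real_normed_vector"
  assumes "v \<noteq> 0"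
  obtains \<phi> :: "'b \<Rightarrow> real" where "bounded_linear \<phi>" "\<phi> v \<noteq> 0"
proof -
  have norm: "sublinear (norm :: 'b \<Rightarrow> real)"
    by (rule sublinearI) (auto intro: norm_triangle_ineq)
  \<comment> \<open>Starting below \<open>slope_inf v norm\<close> forces
    \<open>q (- v) \<le> - norm v\<close>, so \<open>q\<close> cannot vanish at
    \<open>v\<close>.\<close>
  define p0 where "p0 = slope_inf v norm"
  obtain q where q: "sublinear q" "q \<le> p0" and min: "\<And>p. sublinear p \<Longrightarrow> p \<le> q \<Longrightarrow> p = q"
    using exists_minimal_sublinear[OF sublinear_slope_inf[OF norm]] unfolding p0_def by blast
  have add: "q (x + y) = q x + q y" for x y
  proof -
    have "slope_inf y q = q"
      using slope_inf_le[OF q(1), of 0 y]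
      by (intro min sublinear_slope_inf q le_funI) simp
    hence "q x \<le> q (x + y) - q y"
      using slope_inf_le[OF q(1), of 1 y x] by simp
    thus ?thesis using sublinear_add[OF q(1), of x y] by simp
  qed
  have minus: "q (- x) = - q x" for x
    using add[of x "- x"] sublinear_zero[OF q(1)] by simp
  have scale: "q (t *\<^sub>R x) = t *\<^sub>R q x" for t x
  proof (cases "t \<ge> 0")
    case False
    thus ?thesis
      using sublinear_scaleR[OF q(1), of "- t" x] minus[of "t *\<^sub>R x"] by simp
  qed (use sublinear_scaleR[OF q(1)] in simp)
  have le_norm: "q x \<le> norm x" for x
    using slope_inf_le[OF norm, of 0 v x] le_funD[OF q(2), of x] by (simp add: p0_def)
  have "bounded_linear q"
  proof (rule bounded_linear_intro[of _ 1])
    show "norm (q x) \<le> norm x * 1" for x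
      using le_norm[of x] le_norm[of "- x"] by (simp add: minus abs_le_iff)
  qed (simp_all add: add scale)
  moreover have "q (- v) \<le> - norm v"
    using slope_inf_le[OF norm, of 1 v "- v"] le_funD[OF q(2), of "- v"] by (simp add: p0_def)
  hence "norm v \<le> q v" by (simp add: minus)
  hence "q v \<noteq> 0"
    using assms by (metis norm_le_zero_iff)
  ultimately show ?thesis using that by blast
qed

text \<open>Complexification of a real functional \<open>\<phi>\<close>: the real part of
  \<open>\<psi> a\<close> is \<open>\<phi> a\<close>, so \<open>\<psi>\<close> is nonzero at
  \<open>v\<close> as well.\<close>

lemma exists_complex_functional_nonzero:
  fixes v :: "'a::complex_banach_algebra_1"
  assumes "v \<noteq> 0"
  obtains \<psi> :: "'a \<Rightarrow> complex" where "bounded_linear \<psi>" "\<And>c a. \<psi> (c *\<^sub>C a) = c * \<psi> a" "\<psi> v \<noteq> 0"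
proof -
  obtain \<phi> :: "'a \<Rightarrow> real" where \<phi>: "bounded_linear \<phi>" "\<phi> v \<noteq> 0"
    using exists_bounded_linear_nonzero[OF assms] by blast
  interpret \<phi>: bounded_linear \<phi> by (fact \<phi>(1))
  define \<psi> where "\<psi> a = complex_of_real (\<phi> a) - \<i> * complex_of_real (\<phi> (\<i> *\<^sub>C a))" for a
  have "bounded_linear (\<lambda>a::'a. \<i> *\<^sub>C a)"
    by (rule bounded_linear_intro[of _ 1])
      (simp_all add: scaleC_add_right norm_scaleC scaleR_scaleC scaleC_scaleC mult.commute)
  hence "bounded_linear \<psi>"
    unfolding \<psi>_def
    by (intro bounded_linear_sub bounded_linear_const_mult
        bounded_linear_compose[OF bounded_linear_of_real] \<phi>(1)
        bounded_linear_compose[OF \<phi>(1)])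
  moreover have "\<psi> (c *\<^sub>C a) = c * \<psi> a" for c a
  proof -
    have 1: "c *\<^sub>C a = Re c *\<^sub>R a + Im c *\<^sub>R (\<i> *\<^sub>C a)"
      unfolding scaleR_scaleC scaleC_scaleC scaleC_add_left[symmetric]
      by (subst complex_eq) (simp add: mult.commute)
    have 2: "\<i> *\<^sub>C c *\<^sub>C a = Re c *\<^sub>R (\<i> *\<^sub>C a) - Im c *\<^sub>R a"
      unfolding scaleR_scaleC scaleC_scaleC complex_vector.scale_left_diff_distrib[symmetric]
      by (rule arg_cong[of _ _ "\<lambda>c. c *\<^sub>C a"]) (simp add: complex_eq_iff)
    have "\<phi> (c *\<^sub>C a) = Re c * \<phi> a + Im c * \<phi> (\<i> *\<^sub>C a)"
      unfolding 1 by (simp add: \<phi>.add \<phi>.scaleR)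
    moreover have "\<phi> (\<i> *\<^sub>C c *\<^sub>C a) = Re c * \<phi> (\<i> *\<^sub>C a) - Im c * \<phi> a"
      unfolding 2 by (simp add: \<phi>.diff \<phi>.scaleR)
    ultimately show ?thesis
      by (simp add: \<psi>_def complex_eq_iff)
  qed
  moreover have "\<psi> v \<noteq> 0"
    using \<phi>(2) by (simp add: \<psi>_def complex_eq_iff)
  ultimately show ?thesis using that by blast
qed

text \<open>A complex-linear functional nonzero at \<open>f \<mu>\<close> would turn
  \<open>f\<close> into a scalar holomorphic function, not identically zero, whose zeros accumulate
  at \<open>z\<close>.\<close>

lemma holomorphic_vec_eq_zero:
  fixes f :: "complex \<Rightarrow> 'a::complex_banach_algebra_1"
  assumes f: "holomorphic_vec f U" and U: "open U" "connected U" "z \<in> U"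
    and ev: "eventually (\<lambda>\<mu>. f \<mu> = 0) (at z)" and "\<mu> \<in> U"
  shows "f \<mu> = 0"
proof (rule ccontr)
  assume "f \<mu> \<noteq> 0"
  then obtain \<psi> :: "'a \<Rightarrow> complex" where \<psi>: "bounded_linear \<psi>" "\<And>c a. \<psi> (c *\<^sub>C a) = c * \<psi> a"
    "\<psi> (f \<mu>) \<noteq> 0"
    using exists_complex_functional_nonzero by blast
  have "(\<lambda>\<mu>. \<psi> (f \<mu>)) holomorphic_on U"
    unfolding holomorphic_on_def
  proof
    fix \<nu> assume "\<nu> \<in> U"
    then obtain d where "(f has_derivative (\<lambda>h. h *\<^sub>C d)) (at \<nu>)"
      using f unfolding holomorphic_vec_def by blast
    from bounded_linear.has_derivative[OF \<psi>(1) this]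
    have "((\<lambda>\<mu>. \<psi> (f \<mu>)) has_field_derivative \<psi> d) (at \<nu>)"
      by (simp add: has_field_derivative_def \<psi>(2) mult_commute_abs)
    thus "(\<lambda>\<mu>. \<psi> (f \<mu>)) field_differentiable (at \<nu> within U)"
      using field_differentiable_at_within field_differentiable_def by blast
  qed
  moreover obtain e where e: "e > 0" "\<And>\<nu>. \<nu> \<noteq> z \<Longrightarrow> dist \<nu> z < e \<Longrightarrow> f \<nu> = 0"
    using ev unfolding eventually_at by auto
  \<comment> \<open>The hypothesis says nothing about the value at \<open>z\<close>, so the zeros
    fill a punctured ball, which still accumulates at \<open>z\<close>.\<close>
  moreover have "z islimpt (U \<inter> (ball z e - {z}))"
  proof -
    have "z islimpt (U \<inter> ball z e)"
      using U e(1) by (intro interior_limit_point) (auto simp: interior_open open_Int)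
    thus ?thesis
      using islimpt_punctured[of z "U \<inter> ball z e"] by (simp add: Int_Diff)
  qed
  ultimately have "\<psi> (f \<mu>) = 0"
    using U \<open>\<mu> \<in> U\<close> \<psi>(1)
    by (intro analytic_continuation[of "\<lambda>\<mu>. \<psi> (f \<mu>)" U "U \<inter> (ball z e - {z})" z \<mu>])
      (auto simp: dist_commute linear_simps)
  thus False using \<psi>(3) by simp
qed

section \<open>The single-valued extension property\<close>

text \<open>For a chain \<open>y (w^(i + 1) g) = w^i g\<close>, \<open>y g = 0\<close>, the function
  \<open>(1 - z w)^(-1) g = (\<Sum>i. z^i w^i g)\<close> takes values in the eigenspaces of \<open>y\<close>.\<close>

lemma local_eigenvector_function:
  fixes x :: "'a::complex_banach_algebra_1"
  assumes sp: "semiprime_algebra TYPE('a)"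
    and "B_Fredholm (shift x \<zeta>)" "p_l (shift x \<zeta>) = \<infinity>"
  obtains e f where "e > 0" "holomorphic_vec f (ball \<zeta> e)"
    "\<And>\<mu>. \<mu> \<in> ball \<zeta> e \<Longrightarrow> f \<mu> \<noteq> 0 \<and> shift x \<mu> * f \<mu> = 0"
proof -
  define y where "y = shift x \<zeta>"
  obtain g w where g: "g \<noteq> 0" "y * g = 0" and w: "\<And>i. y * (w ^ Suc i * g) = w ^ i * g"
    using eigenvector_chain[OF assms] unfolding y_def by blast
  \<comment> \<open>This radius gives \<open>norm (z w) \<le> 1/2\<close>, so the inverses
    \<open>G z\<close> of \<open>1 - z w\<close> have norm at most 2.\<close>
  define e where "e = 1 / (2 * (norm w + 1))"
  have e: "e > 0" by (simp add: e_def add_nonneg_pos)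
  have small: "norm (z *\<^sub>C w) \<le> 1 / 2" if "cmod z < e" for z
  proof -
    have "norm (z *\<^sub>C w) \<le> e * (norm w + 1)"
      unfolding norm_scaleC using that e by (intro mult_mono) auto
    also have "\<dots> = 1 / 2"
      using add_nonneg_pos[OF norm_ge_zero[of w] zero_less_one] by (simp add: e_def)
    finally show ?thesis .
  qed
  have "\<exists>G. (\<lambda>n. (z *\<^sub>C w) ^ n) sums G \<and> G * (1 - z *\<^sub>C w) = 1 \<and> (1 - z *\<^sub>C w) * G = 1 \<and> norm G \<le> 2"
    if z: "cmod z < e" for z
  proof -
    have "norm (z *\<^sub>C w) < 1" using small[OF z] by linarith
    then obtain G where G: "(\<lambda>n. (z *\<^sub>C w) ^ n) sums G" "G * (1 - z *\<^sub>C w) = 1" "(1 - z *\<^sub>C w) * G = 1"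
      "norm G \<le> 1 / (1 - norm (z *\<^sub>C w))"
      using neumann_series by blast
    have "1 / (1 - norm (z *\<^sub>C w)) \<le> 2"
      using small[OF z] by (simp add: divide_le_eq)
    hence "norm G \<le> 2" using G(4) by linarith
    thus ?thesis using G by blast
  qed
  then obtain G where G: "\<And>z. cmod z < e \<Longrightarrow> (\<lambda>n. (z *\<^sub>C w) ^ n) sums G z"
    "\<And>z. cmod z < e \<Longrightarrow> G z * (1 - z *\<^sub>C w) = 1" "\<And>z. cmod z < e \<Longrightarrow> (1 - z *\<^sub>C w) * G z = 1"
    "\<And>z. cmod z < e \<Longrightarrow> norm (G z) \<le> 2"
    by metis
  \<comment> \<open>The resolvent identity, which identifies the derivative of \<open>G\<close> as
    \<open>G w G\<close>.\<close>
  have resolvent: "G a - G b = (a - b) *\<^sub>C (G a * w * G b)" if "cmod a < e" "cmod b < e" for a b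
  proof -
    have "G a * ((1 - b *\<^sub>C w) - (1 - a *\<^sub>C w)) * G b =
        G a * ((1 - b *\<^sub>C w) * G b) - (G a * (1 - a *\<^sub>C w)) * G b"
      by (simp only: right_diff_distrib left_diff_distrib mult.assoc)
    also have "\<dots> = G a - G b"
      by (simp only: G(2)[OF that(1)] G(3)[OF that(2)] mult_1_left mult_1_right)
    finally have "G a - G b = G a * ((1 - b *\<^sub>C w) - (1 - a *\<^sub>C w)) * G b" ..
    also have "(1 - b *\<^sub>C w) - (1 - a *\<^sub>C w) = (a - b) *\<^sub>C w"
      by (simp add: complex_vector.scale_left_diff_distrib)
    finally show ?thesis by (simp add: mult_scaleC_left mult_scaleC_right)
  qed
  have power_scaleC: "(z *\<^sub>C w) ^ n = z ^ n *\<^sub>C w ^ n" for z n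
    by (induction n) (simp_all add: mult_scaleC_left mult_scaleC_right scaleC_scaleC scaleC_one)
  have eigen: "y * (G z * g) = z *\<^sub>C (G z * g)" if z: "cmod z < e" for z
  proof -
    have *: "(\<lambda>n. (z *\<^sub>C w) ^ n * g) sums (G z * g)"
      by (rule sums_mult2[OF G(1)[OF z]])
    have "(\<lambda>n. y * ((z *\<^sub>C w) ^ n * g)) sums (y * (G z * g))"
      by (rule sums_mult[OF *])
    \<comment> \<open>The zeroth term is \<open>y * g = 0\<close>, so dropping it leaves the sum
      unchanged.\<close>
    hence "(\<lambda>n. y * ((z *\<^sub>C w) ^ Suc n * g)) sums (y * (G z * g))"
      by (subst sums_Suc_iff) (simp add: g)
    moreover have "y * ((z *\<^sub>C w) ^ Suc n * g) = (z *\<^sub>C 1) * ((z *\<^sub>C w) ^ n * g)" for n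
    proof -
      have "y * ((z *\<^sub>C w) ^ Suc n * g) = z ^ Suc n *\<^sub>C (y * (w ^ Suc n * g))"
        by (simp only: power_scaleC mult_scaleC_left mult_scaleC_right)
      also have "\<dots> = z *\<^sub>C z ^ n *\<^sub>C (w ^ n * g)"
        by (simp only: w) (simp add: scaleC_scaleC)
      also have "\<dots> = (z *\<^sub>C 1) * ((z *\<^sub>C w) ^ n * g)"
        by (simp only: power_scaleC mult_scaleC_left mult_1_left)
      finally show ?thesis .
    qed
    ultimately have "(\<lambda>n. (z *\<^sub>C 1) * ((z *\<^sub>C w) ^ n * g)) sums (y * (G z * g))"
      by simp
    moreover have "(\<lambda>n. (z *\<^sub>C 1) * ((z *\<^sub>C w) ^ n * g)) sums ((z *\<^sub>C 1) * (G z * g))"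
      by (rule sums_mult[OF *])
    ultimately show ?thesis
      using sums_unique2 by (metis scaleC_eq_mult)
  qed
  define f where "f \<mu> = G (\<mu> - \<zeta>) * g" for \<mu>
  have "holomorphic_vec f (ball \<zeta> e)"
    unfolding holomorphic_vec_def
  proof (intro ballI exI)
    fix \<mu> assume "\<mu> \<in> ball \<zeta> e"
    hence \<mu>: "cmod (\<mu> - \<zeta>) < e" by (simp add: dist_norm norm_minus_commute)
    define B where "B = G (\<mu> - \<zeta>)"
    \<comment> \<open>Majorant for the error of the difference quotient: two uses of the resolvent
      identity bring the numerator to \<open>(\<nu> - \<mu>)^2 C w B w B g\<close>, and the factors
      \<open>C\<close>, \<open>B\<close>, \<open>B\<close> of norm at most 2 account for the
      8.\<close>
    define H where "H \<nu> = cmod (\<nu> - \<mu>) * (8 * norm w ^ 2 * norm g)" for \<nu>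
    show "(f has_derivative (\<lambda>h. h *\<^sub>C (B * w * B * g))) (at \<mu>)"
    proof (rule has_derivativeI_sandwich[where H = H and e = "e - cmod (\<mu> - \<zeta>)"])
      show "0 < e - cmod (\<mu> - \<zeta>)" using \<mu> by simp
      show "bounded_linear (\<lambda>h. h *\<^sub>C (B * w * B * g))"
        by (rule bounded_linear_intro[of _ "norm (B * w * B * g)"])
          (simp_all add: scaleC_add_left norm_scaleC scaleR_scaleC scaleC_scaleC scaleR_conv_of_real)
      have "H \<midarrow>\<mu>\<rightarrow> cmod (\<mu> - \<mu>) * (8 * norm w ^ 2 * norm g)"
        unfolding H_def by (intro tendsto_intros)
      thus "H \<midarrow>\<mu>\<rightarrow> 0" by simp
      fix \<nu> assume "\<nu> \<noteq> \<mu>" "dist \<nu> \<mu> < e - cmod (\<mu> - \<zeta>)"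
      hence \<nu>: "cmod (\<nu> - \<zeta>) < e"
        using norm_triangle_ineq[of "\<nu> - \<mu>" "\<mu> - \<zeta>"] by (simp add: dist_norm)
      define C where "C = G (\<nu> - \<zeta>)"
      have CB: "C - B = (\<nu> - \<mu>) *\<^sub>C (C * w * B)"
        using resolvent[OF \<nu> \<mu>] by (simp add: C_def B_def)
      have n: "norm C \<le> 2" "norm B \<le> 2"
        using G(4) \<nu> \<mu> by (simp_all add: C_def B_def)
      have "(f \<nu> - f \<mu>) - (\<nu> - \<mu>) *\<^sub>C (B * w * B * g) =
          (\<nu> - \<mu>) *\<^sub>C ((C - B) * w * B * g)"
        unfolding f_def C_def[symmetric] B_def[symmetric] left_diff_distrib[symmetric]
        by (subst CB) (simp add: mult_scaleC_left left_diff_distrib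
            complex_vector.scale_right_diff_distrib)
      also have "\<dots> = (\<nu> - \<mu>) *\<^sub>C (\<nu> - \<mu>) *\<^sub>C (C * w * B * w * B * g)"
        by (subst CB) (simp add: mult_scaleC_left)
      finally have "norm ((f \<nu> - f \<mu>) - (\<nu> - \<mu>) *\<^sub>C (B * w * B * g)) =
          cmod (\<nu> - \<mu>) * (cmod (\<nu> - \<mu>) * norm (C * w * B * w * B * g))"
        by (simp only: norm_scaleC)
      moreover have "norm (C * w * B * w * B * g) \<le> 2 * norm w * 2 * norm w * 2 * norm g"
        by (intro norm_mult_ineq[THEN order_trans] mult_mono n) auto
      hence "cmod (\<nu> - \<mu>) * norm (C * w * B * w * B * g) \<le> H \<nu>"
        unfolding H_def by (intro mult_left_mono) (auto simp: power2_eq_square)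
      ultimately show "norm ((f \<nu> - f \<mu>) - (\<nu> - \<mu>) *\<^sub>C (B * w * B * g)) / norm (\<nu> - \<mu>) \<le> H \<nu>"
        using \<open>\<nu> \<noteq> \<mu>\<close> by simp
    qed
  qed
  moreover have "f \<mu> \<noteq> 0 \<and> shift x \<mu> * f \<mu> = 0" if "\<mu> \<in> ball \<zeta> e" for \<mu>
  proof -
    have \<mu>: "cmod (\<mu> - \<zeta>) < e" using that by (simp add: dist_norm norm_minus_commute)
    \<comment> \<open>Multiplication by \<open>1 - (\<mu> - \<zeta>) w\<close> recovers
      \<open>g \<noteq> 0\<close>, so \<open>f\<close> has no zeros.\<close>
    have "(1 - (\<mu> - \<zeta>) *\<^sub>C w) * f \<mu> = g"
      using G(3)[OF \<mu>] by (simp add: f_def mult.assoc[symmetric])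
    moreover have "shift x \<mu> = y - (\<mu> - \<zeta>) *\<^sub>C 1"
      by (simp add: y_def shift_def complex_vector.scale_left_diff_distrib)
    hence "shift x \<mu> * f \<mu> = 0"
      using eigen[OF \<mu>] by (simp add: f_def left_diff_distrib mult_scaleC_left)
    ultimately show ?thesis using g(1) by auto
  qed
  ultimately show ?thesis using that e by blast
qed

section \<open>Left inverses, the ascent and topological divisors of zero\<close>

lemma left_invertible_cancel: "left_invertible a \<Longrightarrow> a * b = 0 \<Longrightarrow> b = 0"
  unfolding left_invertible_def by (metis mult.assoc mult_1_left mult_zero_right)

lemma left_invertible_p_l: "left_invertible a \<Longrightarrow> p_l a < \<infinity>"
  unfolding p_l_finite_iff
  by (rule exI[of _ 0]) (auto simp: right_annihilator_def dest: left_invertible_cancel)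

lemma left_invertible_not_topological_zero_divisor:
  assumes "left_invertible a"
  shows "\<not> left_topological_zero_divisor a"
proof
  assume "left_topological_zero_divisor a"
  then obtain s where s: "\<And>n. norm (s n) = 1" "(\<lambda>n. a * s n) \<longlonglongrightarrow> 0"
    by (auto simp: left_topological_zero_divisor_def)
  obtain b where "b * a = 1" using assms by (auto simp: left_invertible_def)
  hence "(\<lambda>n. b * (a * s n)) = s"
    by (simp add: mult.assoc[symmetric])
  hence "s \<longlonglongrightarrow> 0"
    using tendsto_mult_left[OF s(2), of b] by simp
  hence "(\<lambda>n. norm (s n)) \<longlonglongrightarrow> 0" by (rule tendsto_norm_zero)
  thus False using s(1) by (simp add: LIMSEQ_const_iff)
qed

lemma zero_divisor_topological_zero_divisor:
  assumes "a * b = 0" "b \<noteq> 0"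
  shows "left_topological_zero_divisor a"
  unfolding left_topological_zero_divisor_def
  by (rule exI[of _ "\<lambda>_. inverse (norm b) *\<^sub>R b"]) (use assms in simp)

text \<open>Singletons are relatively open in such a set, and the Lindelof property reduces their
  cover to a countable one.\<close>

lemma countable_of_isolated:
  fixes E :: "'b::second_countable_topology set"
  assumes "\<And>z. z \<in> E \<Longrightarrow> z isolated_in E"
  shows "countable E"
proof -
  have "openin (top_of_set E) S" if S: "S \<in> (\<lambda>z. {z}) ` E" for S
  proof -
    obtain z where z: "z \<in> E" "S = {z}" using S by blast
    then obtain T where "open T" "T \<inter> E = {z}"
      using assms unfolding isolated_in_def by blast
    thus ?thesis using z(2) by (auto simp: openin_open)
  qed
  then obtain F where F: "F \<subseteq> (\<lambda>z. {z}) ` E" "countable F" "\<Union>F = \<Union>((\<lambda>z. {z}) ` E)"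
    using Lindelof_openin[of "(\<lambda>z. {z}) ` E" E] by blast
  have "countable (\<Union>F)"
    using countable_UN[OF F(2), of "\<lambda>S. S"] F(1) by auto
  thus ?thesis using F(3) by simp
qed

lemma eventually_left_invertible:
  fixes x :: "'a::complex_banach_algebra_1"
  assumes "semiprime_algebra TYPE('a)" "B_Fredholm (shift x z)" "p_l (shift x z) < \<infinity>"
  shows "eventually (\<lambda>\<mu>. left_invertible (shift x \<mu>)) (at z)"
proof -
  obtain e where e: "e > 0" "\<And>t. t \<noteq> 0 \<Longrightarrow> cmod t < e \<Longrightarrow> left_invertible (shift (shift x z) t)"
    using left_invertible_punctured_neighbourhood[OF assms] by blast
  have "shift (shift x z) (\<mu> - z) = shift x \<mu>" for \<mu>
    by (simp add: shift_def complex_vector.scale_left_diff_distrib)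
  thus ?thesis
    unfolding eventually_at using e by (metis dist_norm right_minus_eq)
qed

text \<open>Left invertibility near \<open>z\<close>, off \<open>z\<close> itself, forces
  \<open>f\<close> to vanish there; the identity theorem extends this to all of
  \<open>U\<close>.\<close>

lemma left_SVEP_at_of_p_l_finite:
  fixes x :: "'a::complex_banach_algebra_1"
  assumes "semiprime_algebra TYPE('a)" "B_Fredholm (shift x z)" "p_l (shift x z) < \<infinity>"
  shows "left_SVEP_at x z"
  unfolding left_SVEP_at_def
proof (intro allI impI ballI)
  fix U f \<mu>
  assume U: "open U \<and> connected U \<and> z \<in> U"
    and f: "holomorphic_vec f U \<and> (\<forall>\<mu>\<in>U. (\<mu> *\<^sub>C 1 - x) * f \<mu> = 0)" and "\<mu> \<in> U"
  have *: "f \<nu> = 0" if "left_invertible (shift x \<nu>)" "\<nu> \<in> U" for \<nu>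
  proof (rule left_invertible_cancel[OF that(1)])
    have "shift x \<nu> * f \<nu> = - ((\<nu> *\<^sub>C 1 - x) * f \<nu>)"
      by (simp add: shift_def left_diff_distrib)
    thus "shift x \<nu> * f \<nu> = 0" using f that(2) by simp
  qed
  have "eventually (\<lambda>\<nu>. \<nu> \<in> U) (at z)"
    using U by (metis eventually_at_topological)
  with eventually_left_invertible[OF assms] have "eventually (\<lambda>\<nu>. f \<nu> = 0) (at z)"
    by eventually_elim (rule *)
  thus "f \<mu> = 0"
    using holomorphic_vec_eq_zero U f \<open>\<mu> \<in> U\<close> by blast
qed

text \<open>Finite ascent at a B-Fredholm point \<open>\<mu>\<close> of the ball would make
  \<open>x - \<nu>\<close> left invertible for \<open>\<nu> \<noteq> \<mu>\<close> near
  \<open>\<mu>\<close>, although it annihilates the nonzero value \<open>f \<nu>\<close>.\<close>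

lemma eventually_p_l_infinite:
  fixes x :: "'a::complex_banach_algebra_1"
  assumes sp: "semiprime_algebra TYPE('a)"
    and z: "B_Fredholm (shift x z)" "p_l (shift x z) = \<infinity>"
  shows "eventually (\<lambda>\<mu>. B_Fredholm (shift x \<mu>) \<longrightarrow> p_l (shift x \<mu>) = \<infinity>) (at z)"
proof -
  obtain e f where e: "e > 0" and f: "\<And>\<mu>. \<mu> \<in> ball z e \<Longrightarrow> f \<mu> \<noteq> 0 \<and> shift x \<mu> * f \<mu> = 0"
    using local_eigenvector_function[OF sp z] by blast
  have "p_l (shift x \<mu>) = \<infinity>" if \<mu>: "\<mu> \<in> ball z e" "B_Fredholm (shift x \<mu>)" for \<mu>
  proof (rule ccontr)
    assume "p_l (shift x \<mu>) \<noteq> \<infinity>"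
    hence "eventually (\<lambda>\<nu>. left_invertible (shift x \<nu>)) (at \<mu>)"
      using eventually_left_invertible[OF sp \<mu>(2)] by simp
    moreover have "eventually (\<lambda>\<nu>. \<nu> \<in> ball z e) (at \<mu>)"
      using \<mu>(1) by (metis eventually_at_topological open_ball)
    ultimately have "eventually (\<lambda>\<nu>. False) (at \<mu>)"
      by eventually_elim (use f left_invertible_cancel in blast)
    thus False by simp
  qed
  moreover have "eventually (\<lambda>\<mu>. \<mu> \<in> ball z e) (at z)"
    using e by (intro eventually_at_in_open') auto
  ultimately show ?thesis by (auto elim: eventually_mono)
qed

lemma not_left_SVEP_at_of_p_l_infinite:
  fixes x :: "'a::complex_banach_algebra_1"
  assumes sp: "semiprime_algebra TYPE('a)"
    and z: "B_Fredholm (shift x z)" "p_l (shift x z) = \<infinity>"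
  shows "\<not> left_SVEP_at x z"
proof -
  obtain e f where e: "e > 0" and hol: "holomorphic_vec f (ball z e)"
    and f: "\<And>\<mu>. \<mu> \<in> ball z e \<Longrightarrow> f \<mu> \<noteq> 0 \<and> shift x \<mu> * f \<mu> = 0"
    using local_eigenvector_function[OF sp z] by blast
  have "(\<mu> *\<^sub>C 1 - x) * f \<mu> = 0" if "\<mu> \<in> ball z e" for \<mu>
    using f[OF that] by (simp add: shift_def left_diff_distrib)
  moreover have "z \<in> ball z e" using e by simp
  ultimately show ?thesis
    using hol f unfolding left_SVEP_at_def by (metis connected_ball open_ball)
qed

theorem theorem4p1:
  fixes x :: "'a::complex_banach_algebra_1" and \<Omega> :: "complex set"
  assumes "semiprime_algebra TYPE('a)"
    and "(soc :: 'a set) \<noteq> {0}"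
    and "\<Omega> \<in> components (rho_BF x)"
  shows
    "((\<forall>z\<in>\<Omega>. left_SVEP_at x z) \<and>
      (\<forall>z\<in>\<Omega>. p_l (shift x z) < \<infinity>) \<and>
      (\<forall>z\<in>\<Omega>. \<not> z islimpt sigma_l x) \<and>
      (\<exists>E\<subseteq>\<Omega>. countable E \<and> (\<forall>z\<in>E. z isolated_in E) \<and>
         (\<forall>z\<in>\<Omega> - E. \<not> left_topological_zero_divisor (shift x z))))
     \<or>
     ((\<forall>z\<in>\<Omega>. \<not> left_SVEP_at x z) \<and>
      (\<forall>z\<in>\<Omega>. p_l (shift x z) = \<infinity>) \<and>
      (\<forall>z\<in>\<Omega>. left_topological_zero_divisor (shift x z)))"
proof -
  note sp = assms(1)
  have BF: "B_Fredholm (shift x z)" if "z \<in> \<Omega>" for z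
    using in_components_subset[OF assms(3)] that by (auto simp: rho_BF_def sigma_BF_def)
  \<comment> \<open>Local constancy relative to \<open>\<Omega>\<close>: left invertibility at
    nearby points propagates finite ascent, and the local eigenvector function propagates infinite
    ascent.\<close>
  have "eventually (\<lambda>b. (p_l (shift x a) < \<infinity>) = (p_l (shift x b) < \<infinity>)) (at a within \<Omega>)"
    if a: "a \<in> \<Omega>" for a
  proof (cases "p_l (shift x a) < \<infinity>")
    case True
    have "eventually (\<lambda>b. left_invertible (shift x b)) (at a within \<Omega>)"
      using eventually_left_invertible[OF sp BF[OF a] True] by (rule filter_leD[OF at_le, rotated]) simp
    thus ?thesis
      by eventually_elim (use True left_invertible_p_l in blast)
  next
    case False
    have "eventually (\<lambda>b. B_Fredholm (shift x b) \<longrightarrow> p_l (shift x b) = \<infinity>) (at a within \<Omega>)"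
      using eventually_p_l_infinite[OF sp BF[OF a]] False
      by (intro filter_leD[OF at_le[of \<Omega> UNIV]]) auto
    \<comment> \<open>Membership in \<open>\<Omega>\<close> supplies the B-Fredholm premise.\<close>
    moreover have "eventually (\<lambda>b. b \<in> \<Omega>) (at a within \<Omega>)"
      by (simp add: eventually_at_filter)
    ultimately show ?thesis
    proof eventually_elim
      case (elim b)
      hence "p_l (shift x b) = \<infinity>" using BF by blast
      thus ?case using False by simp
    qed
  qed
  hence const: "(p_l (shift x a) < \<infinity>) = (p_l (shift x b) < \<infinity>)" if "a \<in> \<Omega>" "b \<in> \<Omega>" for a b
    using connected_local_const[OF in_components_connected[OF assms(3)] that,
        of "\<lambda>a. p_l (shift x a) < \<infinity>"] by blast
  show ?thesis
  proof (cases "\<exists>a\<in>\<Omega>. p_l (shift x a) < \<infinity>")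
    case True
    hence fin: "p_l (shift x z) < \<infinity>" if "z \<in> \<Omega>" for z
      using const that by blast
    have nlim: "\<not> z islimpt sigma_l x" if "z \<in> \<Omega>" for z
      using eventually_left_invertible[OF sp BF[OF that] fin[OF that]]
      by (simp add: islimpt_iff_eventually sigma_l_def)
    \<comment> \<open>The exceptional set is the left spectrum inside \<open>\<Omega>\<close>;
      without limit points in \<open>\<Omega>\<close> it consists of isolated points and is
      therefore countable.\<close>
    define E where "E = \<Omega> \<inter> sigma_l x"
    have iso: "z isolated_in E" if "z \<in> E" for z
      using that nlim[of z] islimpt_subset[of z E "sigma_l x"]
      by (auto simp: isolated_in_islimpt_iff E_def)
    have "\<not> left_topological_zero_divisor (shift x z)" if "z \<in> \<Omega> - E" for z
      using that by (intro left_invertible_not_topological_zero_divisor) (auto simp: E_def sigma_l_def)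
    moreover have "E \<subseteq> \<Omega>" by (simp add: E_def)
    ultimately show ?thesis
      using fin nlim iso countable_of_isolated[of E] left_SVEP_at_of_p_l_finite[OF sp BF]
      by (intro disjI1 conjI ballI exI[of _ E]) auto
  next
    case False
    hence inf: "p_l (shift x z) = \<infinity>" if "z \<in> \<Omega>" for z
      using that by auto
    have "left_topological_zero_divisor (shift x z)" if z: "z \<in> \<Omega>" for z
    proof -
      obtain e f where "e > 0" "\<And>\<mu>. \<mu> \<in> ball z e \<Longrightarrow> f \<mu> \<noteq> 0 \<and> shift x \<mu> * f \<mu> = (0::'a)"
        using local_eigenvector_function[OF sp BF[OF z] inf[OF z]] by blast
      thus ?thesis
        using zero_divisor_topological_zero_divisor by (metis centre_in_ball)
    qed
    thus ?thesis
      using inf not_left_SVEP_at_of_p_l_infinite[OF sp BF] by blast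
  qed
qed

end
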